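(* Let $\big(\widetilde{\omega^{(n)}}\big)_{n\ge0}$ be the state sequence of the $d$-dimensional open QBN walk. Then it satisfies the evolution equation $$\widetilde{\omega^{(n+1)}}=\mathsf{M}^{(n)}\big(\widetilde{\omega^{(n)}}\big),\qquad n\ge0.$$
   Context: Let $d\ge 2$ be a fixed integer, $\mathbb{N}=\{0,1,2,\dots\}$, $\Lambda=\{-1,+1\}$, and $\Gamma$ the set of finite subsets of $\mathbb{N}$. Bernoulli functionals. Let $\Omega$ be the set of all functions $f\colon\mathbb{N}\to\{-1,1\}$, $\zeta_n(f)=f(n)$, $\mathscr{F}$ the $\sigma$-field generated by $(\zeta_n)_{n\ge0}$, $(p_n)_{n\ge0}$ a given sequence with $0<p_n<1$, $q_n=1-p_n$, and $\mathbb{P}$ the unique probability measure on $\mathscr{F}$ with $\mathbb{P}(\zeta_{n_1}=\epsilon_1,\dots,\zeta_{n_k}=\epsilon_k)=\prod_{j=1}^k p_{n_j}^{(1+\epsilon_j)/2}(1-p_{n_j})^{(1-\epsilon_j)/2}$ for all $k\ge 1$, distinct $n_1,\dots,n_k\in\mathbb{N}$ and $\epsilon_j\in\{-1,1\}$. Put $Z_n=(\zeta_n+q_n-p_n)/(2\sqrt{p_nq_n})$, $\mathcal{H}=L^2(\Omega,\mathscr{F},\mathbb{P})$ (complex-valued), $Z_\emptyset=1$ and $Z_\sigma=\prod_{j\in\sigma}Z_j$ for nonempty $\sigma\in\Gamma$; $\{Z_\sigma\mid\sigma\in\Gamma\}$ is an orthonormal basis of $\mathcal{H}$. For $k\ge0$,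 $\partial_k$ is the bounded operator on $\mathcal{H}$ with $\partial_kZ_\sigma=\mathbf{1}_\sigma(k)Z_{\sigma\setminus\{k\}}$; its adjoint satisfies $\partial_k^*Z_\sigma=[1-\mathbf{1}_\sigma(k)]Z_{\sigma\cup\{k\}}$. Put $L_n=\frac12(\partial_n^*+\partial_n-I)$ and $R_n=\frac12(\partial_n^*+\partial_n+I)$, $I$ being the identity on $\mathcal{H}$. Operators $C_n^{(\varepsilon)}$. Fix a unitary isomorphism $\mathsf{K}\colon\mathcal{H}^{\otimes d}\to\mathcal{H}$ ($\mathcal{H}^{\otimes d}$ is the $d$-fold Hilbert space tensor product). For $n\ge0$ and $\varepsilon=(\varepsilon_1,\dots,\varepsilon_d)\in\Lambda^d$ set $C_n^{(\varepsilon)}=\mathsf{K}\big(\bigotimes_{j=1}^dB_n^{(\varepsilon_j)}\big)\mathsf{K}^{-1}$, where $B_n^{(-1)}=L_n$ and $B_n^{(+1)}=R_n$. Nucleuses and the walk. $\mathfrak{S}_+(\mathcal{H})$ is the cone of positive trace class operators on $\mathcal{H}$. A $d$-dimensional nucleus on $\mathcal{H}$ is a mapping $\omega\colon\mathbb{Z}^d\to\mathfrak{S}_+(\mathcal{H})$ with $\sum_{\mathrm{x}\in\mathbb{Z}^d}\mathrm{Tr}[\omega(\mathrm{x})]=1$; the set of all of them is $\mathscr{T}^{(d)}(\mathcal{H})$. Define $\mathfrak{J}_n^{(d)}\colon\mathscr{T}^{(d)}(\mathcal{H})\to\mathscr{T}^{(d)}(\mathcal{H})$ by $[\mathfrak{J}_n^{(d)}\omega](\mathrm{x})=\sum_{\varepsilon\in\Lambda^d}C_n^{(\varepsilon)}\omega(\mathrm{x}-\varepsilon)C_n^{(\varepsilon)}$.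 Let $\{\delta_{\mathrm{x}}\mid\mathrm{x}\in\mathbb{Z}^d\}$ be the canonical orthonormal basis of $l^2(\mathbb{Z}^d)$, and $|u\rangle\langle v|$ the rank-one operator $w\mapsto\langle v,w\rangle u$ (inner product linear in the second argument). The state of the $d$-dimensional open QBN walk at time $n\ge0$ is a density operator on $l^2(\mathbb{Z}^d)\otimes\mathcal{H}$ of the form $\widetilde{\omega^{(n)}}=\sum_{\mathrm{x}\in\mathbb{Z}^d}|\delta_{\mathrm{x}}\rangle\langle\delta_{\mathrm{x}}|\otimes\omega^{(n)}(\mathrm{x})$ (convergent in trace norm) with $\omega^{(n)}\in\mathscr{T}^{(d)}(\mathcal{H})$, called its nucleus; the evolution is $\omega^{(n+1)}=\mathfrak{J}_n^{(d)}\omega^{(n)}$, $n\ge0$. The maps $\mathsf{M}^{(n)}$. For $n\ge0$ and $\mathrm{x},\mathrm{y}\in\mathbb{Z}^d$ let $M^{(n)}_{\mathrm{x},\mathrm{y}}=|\delta_{\mathrm{x}}\rangle\langle\delta_{\mathrm{y}}|\otimes C_n^{(\mathrm{x}-\mathrm{y})}$ if $\mathrm{x}-\mathrm{y}\in\Lambda^d$ and $M^{(n)}_{\mathrm{x},\mathrm{y}}=0$ otherwise. With $\mathfrak{S}(\cdot)$ denoting the space of trace class operators, $\mathsf{M}^{(n)}\colon\mathfrak{S}(l^2(\mathbb{Z}^d)\otimes\mathcal{H})\to\mathfrak{S}(l^2(\mathbb{Z}^d)\otimes\mathcal{H})$ is defined by $\mathsf{M}^{(n)}(\widetilde{\omega})=\sum_{\mathrm{x},\mathrm{y}\in\mathbb{Z}^d}M^{(n)}_{\mathrm{x},\mathrm{y}}\,\widetilde{\omega}\,{M^{(n)}_{\mathrm{x},\mathrm{y}}}^*$,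 the series converging in trace norm. *)

theory Defs
  imports "HOL-Analysis.Analysis"
begin

section \<open>Complex Hilbert spaces\<close>

text \<open>The inner product is linear in its second argument. The axiom \<open>cinner_self\<close> contains
  positivity, definiteness and the fact that the norm is the one induced by the inner product.\<close>

class chilbert_space = banach +
  fixes scaleC :: "complex \<Rightarrow> 'a \<Rightarrow> 'a" (infixr "*\<^sub>C" 75)
    and cinner :: "'a \<Rightarrow> 'a \<Rightarrow> complex"
  assumes scaleC_add_right: "a *\<^sub>C (x + y) = a *\<^sub>C x + a *\<^sub>C y"
    and scaleC_add_left: "(a + b) *\<^sub>C x = a *\<^sub>C x + b *\<^sub>C x"
    and scaleC_scaleC: "a *\<^sub>C (b *\<^sub>C x) = (a * b) *\<^sub>C x"
    and scaleC_one: "1 *\<^sub>C x = x"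
    and scaleC_of_real: "complex_of_real r *\<^sub>C x = r *\<^sub>R x"
    and cinner_commute: "cinner x y = cnj (cinner y x)"
    and cinner_add_right: "cinner x (y + z) = cinner x y + cinner x z"
    and cinner_scaleC_right: "cinner x (a *\<^sub>C y) = a * cinner x y"
    and cinner_self: "cinner x x = complex_of_real ((norm x)\<^sup>2)"

instantiation complex :: chilbert_space
begin

definition scaleC_complex :: "complex \<Rightarrow> complex \<Rightarrow> complex"
  where "scaleC_complex a x = a * x"

definition cinner_complex :: "complex \<Rightarrow> complex \<Rightarrow> complex"
  where "cinner_complex x y = cnj x * y"

instance
proof
  fix x :: complex
  show "cinner x x = complex_of_real ((norm x)\<^sup>2)"
    by (metis cinner_complex_def complex_norm_square mult.commute)
qed (simp_all add: scaleC_complex_def cinner_complex_def algebra_simps scaleR_conv_of_real)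

end

global_interpretation complex_vector:
  vector_space "scaleC :: complex \<Rightarrow> 'a \<Rightarrow> 'a::chilbert_space"
  defines cspan = complex_vector.span
  by unfold_locales
    (simp_all add: scaleC_add_right scaleC_add_left scaleC_scaleC scaleC_one)

definition bounded_clinear :: "('a::chilbert_space \<Rightarrow> 'b::chilbert_space) \<Rightarrow> bool"
  where "bounded_clinear A \<longleftrightarrow> bounded_linear A \<and> (\<forall>c x. A (c *\<^sub>C x) = c *\<^sub>C A x)"

definition cadjoint :: "('a::chilbert_space \<Rightarrow> 'b::chilbert_space) \<Rightarrow> 'b \<Rightarrow> 'a"
  where "cadjoint A = (THE B. \<forall>x y. cinner (B y) x = cinner y (A x))"

definition unitary_iso :: "('a::chilbert_space \<Rightarrow> 'b::chilbert_space) \<Rightarrow> bool"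
  where "unitary_iso U \<longleftrightarrow>
    bounded_clinear U \<and> surj U \<and> (\<forall>x y. cinner (U x) (U y) = cinner x y)"

definition ketbra :: "'a::chilbert_space \<Rightarrow> 'b::chilbert_space \<Rightarrow> 'b \<Rightarrow> 'a"
  where "ketbra u v = (\<lambda>w. cinner v w *\<^sub>C u)"

section \<open>Trace class operators\<close>

definition positive_op :: "('a::chilbert_space \<Rightarrow> 'a) \<Rightarrow> bool"
  where "positive_op A \<longleftrightarrow>
    bounded_clinear A \<and> (\<forall>x. cinner x (A x) \<in> \<real> \<and> 0 \<le> Re (cinner x (A x)))"

definition abs_op :: "('a::chilbert_space \<Rightarrow> 'a) \<Rightarrow> 'a \<Rightarrow> 'a"
  where "abs_op A = (THE P. positive_op P \<and> P \<circ> P = cadjoint A \<circ> A)"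

definition is_onb :: "'a::chilbert_space set \<Rightarrow> bool"
  where "is_onb E \<longleftrightarrow>
    (\<forall>e\<in>E. \<forall>f\<in>E. cinner e f = (if e = f then 1 else 0)) \<and> closure (cspan E) = UNIV"

definition some_onb :: "'a::chilbert_space set"
  where "some_onb = (SOME E. is_onb E)"

text \<open>The trace norm $\mathrm{Tr}\,|A|$ takes the value \<open>\<infinity>\<close> when \<open>A\<close> is not of trace class. Traces
  do not depend on the basis, so a fixed basis is used.\<close>

definition trace_norm :: "('a::chilbert_space \<Rightarrow> 'a) \<Rightarrow> ennreal"
  where "trace_norm A = (\<Sum>\<^sub>\<infinity>e\<in>some_onb. ennreal (Re (cinner e (abs_op A e))))"

definition trace_class :: "('a::chilbert_space \<Rightarrow> 'a) \<Rightarrow> bool"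
  where "trace_class A \<longleftrightarrow> bounded_clinear A \<and> trace_norm A < \<infinity>"

definition op_trace :: "('a::chilbert_space \<Rightarrow> 'a) \<Rightarrow> complex"
  where "op_trace A = (\<Sum>\<^sub>\<infinity>e\<in>some_onb. cinner e (A e))"

definition density_op :: "('a::chilbert_space \<Rightarrow> 'a) \<Rightarrow> bool"
  where "density_op A \<longleftrightarrow> positive_op A \<and> trace_class A \<and> op_trace A = 1"

text \<open>Unconditional summation in the normed space of trace class operators, modelled on
  \<open>has_sum\<close> and \<open>infsum\<close>. In particular \<open>trace_infsum\<close> is the zero operator for a family that is
  not summable in trace norm; the zero operator is never a density operator.\<close>

definition trace_has_sum ::
    "('i \<Rightarrow> 'a::chilbert_space \<Rightarrow> 'a) \<Rightarrow> 'i set \<Rightarrow> ('a \<Rightarrow> 'a) \<Rightarrow> bool"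
  where "trace_has_sum A I S \<longleftrightarrow>
    (\<forall>i\<in>I. trace_class (A i)) \<and> trace_class S \<and>
    ((\<lambda>F. trace_norm (\<lambda>u. (\<Sum>i\<in>F. A i u) - S u)) \<longlongrightarrow> 0) (finite_subsets_at_top I)"

definition trace_infsum ::
    "('i \<Rightarrow> 'a::chilbert_space \<Rightarrow> 'a) \<Rightarrow> 'i set \<Rightarrow> 'a \<Rightarrow> 'a"
  where "trace_infsum A I =
    (if \<exists>S. trace_has_sum A I S then THE S. trace_has_sum A I S else (\<lambda>_. 0))"

section \<open>Hilbert space tensor products\<close>

text \<open>\<open>is_tensor t\<close> says that the codomain, with \<open>t u v\<close> in the role of the elementary tensor
  $u \otimes v$, is the Hilbert space tensor product of the two argument spaces;
  \<open>is_tensor_power t\<close> says the same for the tensor power of \<open>'a\<close> with factors indexed by the finite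
  type \<open>'d\<close>. This determines the product up to a unique unitary isomorphism preserving
  elementary tensors.\<close>

definition is_tensor ::
    "('a::chilbert_space \<Rightarrow> 'b::chilbert_space \<Rightarrow> 'c::chilbert_space) \<Rightarrow> bool"
  where "is_tensor t \<longleftrightarrow>
    (\<forall>v. bounded_clinear (\<lambda>u. t u v)) \<and> (\<forall>u. bounded_clinear (t u)) \<and>
    (\<forall>u v u' v'. cinner (t u v) (t u' v') = cinner u u' * cinner v v') \<and>
    closure (cspan {t u v | u v. True}) = UNIV"

definition is_tensor_power ::
    "(('d::finite \<Rightarrow> 'a::chilbert_space) \<Rightarrow> 'c::chilbert_space) \<Rightarrow> bool"
  where "is_tensor_power t \<longleftrightarrow>
    (\<forall>u j. bounded_clinear (\<lambda>v. t (u(j := v)))) \<and>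
    (\<forall>u v. cinner (t u) (t v) = (\<Prod>j\<in>UNIV. cinner (u j) (v j))) \<and>
    closure (cspan (range t)) = UNIV"

definition tensor_op ::
    "('a::chilbert_space \<Rightarrow> 'b::chilbert_space \<Rightarrow> 'c::chilbert_space) \<Rightarrow>
     ('a \<Rightarrow> 'a) \<Rightarrow> ('b \<Rightarrow> 'b) \<Rightarrow> 'c \<Rightarrow> 'c"
  where "tensor_op t A B =
    (THE S. bounded_clinear S \<and> (\<forall>u v. S (t u v) = t (A u) (B v)))"

definition tensor_power_op ::
    "(('d::finite \<Rightarrow> 'a::chilbert_space) \<Rightarrow> 'c::chilbert_space) \<Rightarrow>
     ('d \<Rightarrow> 'a \<Rightarrow> 'a) \<Rightarrow> 'c \<Rightarrow> 'c"
  where "tensor_power_op t A =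
    (THE S. bounded_clinear S \<and> (\<forall>u. S (t u) = t (\<lambda>j. A j (u j))))"

section \<open>Spaces of square integrable functions\<close>

definition square_integrable :: "'s measure \<Rightarrow> ('s \<Rightarrow> complex) \<Rightarrow> bool"
  where "square_integrable M f \<longleftrightarrow>
    f \<in> borel_measurable M \<and> integrable M (\<lambda>s. (cmod (f s))\<^sup>2)"

text \<open>The space $L^2(M)$ depends on the measure, hence cannot be a type by itself.
  \<open>is_L2 M cls\<close> says that the Hilbert space \<open>'h\<close> is $L^2(M)$, with \<open>cls f\<close> the class of the square
  integrable function \<open>f\<close>. By the formula for the inner product, \<open>cls f = cls g\<close> iff \<open>f\<close> and
  \<open>g\<close> agree almost everywhere. For a counting measure this is $l^2$.\<close>

definition is_L2 :: "'s measure \<Rightarrow> (('s \<Rightarrow> complex) \<Rightarrow> 'h::chilbert_space) \<Rightarrow> bool"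
  where "is_L2 M cls \<longleftrightarrow>
    (\<forall>f g. square_integrable M f \<longrightarrow> square_integrable M g \<longrightarrow>
       cls (\<lambda>s. f s + g s) = cls f + cls g) \<and>
    (\<forall>c f. square_integrable M f \<longrightarrow> cls (\<lambda>s. c * f s) = c *\<^sub>C cls f) \<and>
    (\<forall>f g. square_integrable M f \<longrightarrow> square_integrable M g \<longrightarrow>
       cinner (cls f) (cls g) = (\<integral>s. cnj (f s) * g s \<partial>M)) \<and>
    (\<forall>h. \<exists>f. square_integrable M f \<and> cls f = h)"

abbreviation is_l2 :: "(('i \<Rightarrow> complex) \<Rightarrow> 'l::chilbert_space) \<Rightarrow> bool"
  where "is_l2 cls \<equiv> is_L2 (count_space UNIV) cls"

definition delta :: "(('i \<Rightarrow> complex) \<Rightarrow> 'l) \<Rightarrow> 'i \<Rightarrow> 'l"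
  where "delta cls x = cls (\<lambda>y. if y = x then 1 else 0)"

section \<open>Bernoulli functionals\<close>

definition Omega :: "(nat \<Rightarrow> real) set"
  where "Omega = {f. \<forall>n. f n \<in> {-1, 1}}"

definition zeta :: "nat \<Rightarrow> (nat \<Rightarrow> real) \<Rightarrow> real"
  where "zeta n f = f n"

definition bernoulli_measure :: "(nat \<Rightarrow> real) \<Rightarrow> (nat \<Rightarrow> real) measure \<Rightarrow> bool"
  where "bernoulli_measure p P \<longleftrightarrow>
    space P = Omega \<and>
    sets P = sigma_sets Omega {zeta n -` A \<inter> Omega | n A. A \<in> sets borel} \<and>
    emeasure P Omega = 1 \<and>
    (\<forall>N \<epsilon>. finite N \<and> N \<noteq> {} \<and> (\<forall>n\<in>N. \<epsilon> n \<in> {-1, 1}) \<longrightarrow>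
       measure P {f \<in> Omega. \<forall>n\<in>N. zeta n f = \<epsilon> n} =
       (\<Prod>n\<in>N. p n powr ((1 + \<epsilon> n) / 2) * (1 - p n) powr ((1 - \<epsilon> n) / 2)))"

definition Z1 :: "(nat \<Rightarrow> real) \<Rightarrow> nat \<Rightarrow> (nat \<Rightarrow> real) \<Rightarrow> real"
  where "Z1 p n f = (zeta n f + (1 - p n) - p n) / (2 * sqrt (p n * (1 - p n)))"

definition Z ::
    "(nat \<Rightarrow> real) \<Rightarrow> (((nat \<Rightarrow> real) \<Rightarrow> complex) \<Rightarrow> 'h) \<Rightarrow> nat set \<Rightarrow> 'h"
  where "Z p cls \<sigma> = cls (\<lambda>f. complex_of_real (\<Prod>j\<in>\<sigma>. Z1 p j f))"

text \<open>The bounded operators $\partial_k$ are determined by their values on the orthonormal basis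
  $(Z_\sigma)$.\<close>

definition annihilation_ops ::
    "(nat \<Rightarrow> real) \<Rightarrow> (((nat \<Rightarrow> real) \<Rightarrow> complex) \<Rightarrow> 'h::chilbert_space) \<Rightarrow>
     (nat \<Rightarrow> 'h \<Rightarrow> 'h) \<Rightarrow> bool"
  where "annihilation_ops p cls D \<longleftrightarrow>
    (\<forall>k. bounded_clinear (D k) \<and>
       (\<forall>\<sigma>. finite \<sigma> \<longrightarrow> D k (Z p cls \<sigma>) = (if k \<in> \<sigma> then Z p cls (\<sigma> - {k}) else 0)))"

section \<open>The open QBN walk\<close>

text \<open>Throughout, \<open>D\<close> is the sequence of annihilation operators, \<open>tp\<close> the elementary tensor map of
  the \<open>d\<close>-fold tensor power of $\mathcal{H}$ (where \<open>d = CARD('d)\<close>), and \<open>K\<close> the unitary isomorphism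
  from that tensor power to $\mathcal{H}$.\<close>

definition L_op :: "(nat \<Rightarrow> 'h::chilbert_space \<Rightarrow> 'h) \<Rightarrow> nat \<Rightarrow> 'h \<Rightarrow> 'h"
  where "L_op D n u = (1/2) *\<^sub>C (cadjoint (D n) u + D n u - u)"

definition R_op :: "(nat \<Rightarrow> 'h::chilbert_space \<Rightarrow> 'h) \<Rightarrow> nat \<Rightarrow> 'h \<Rightarrow> 'h"
  where "R_op D n u = (1/2) *\<^sub>C (cadjoint (D n) u + D n u + u)"

definition B_op :: "(nat \<Rightarrow> 'h::chilbert_space \<Rightarrow> 'h) \<Rightarrow> nat \<Rightarrow> int \<Rightarrow> 'h \<Rightarrow> 'h"
  where "B_op D n s = (if s = -1 then L_op D n else R_op D n)"

definition Lambda_d :: "(int ^ 'd) set"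
  where "Lambda_d = {\<epsilon>. \<forall>j. \<epsilon> $ j \<in> {-1, 1}}"

definition C_op ::
    "(nat \<Rightarrow> 'h::chilbert_space \<Rightarrow> 'h) \<Rightarrow> (('d::finite \<Rightarrow> 'h) \<Rightarrow> 't::chilbert_space) \<Rightarrow>
     ('t \<Rightarrow> 'h) \<Rightarrow> nat \<Rightarrow> int ^ 'd \<Rightarrow> 'h \<Rightarrow> 'h"
  where "C_op D tp K n \<epsilon> = K \<circ> tensor_power_op tp (\<lambda>j. B_op D n (\<epsilon> $ j)) \<circ> inv K"

definition nucleus :: "(int ^ 'd::finite \<Rightarrow> 'h::chilbert_space \<Rightarrow> 'h) \<Rightarrow> bool"
  where "nucleus \<omega> \<longleftrightarrow>
    (\<forall>x. positive_op (\<omega> x) \<and> trace_class (\<omega> x)) \<and>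
    ((\<lambda>x. op_trace (\<omega> x)) has_sum 1) UNIV"

definition J_map ::
    "(nat \<Rightarrow> 'h::chilbert_space \<Rightarrow> 'h) \<Rightarrow> (('d::finite \<Rightarrow> 'h) \<Rightarrow> 't::chilbert_space) \<Rightarrow>
     ('t \<Rightarrow> 'h) \<Rightarrow> nat \<Rightarrow> (int ^ 'd \<Rightarrow> 'h \<Rightarrow> 'h) \<Rightarrow> int ^ 'd \<Rightarrow> 'h \<Rightarrow> 'h"
  where "J_map D tp K n \<omega> x =
    (\<lambda>u. \<Sum>\<epsilon>\<in>Lambda_d. C_op D tp K n \<epsilon> (\<omega> (x - \<epsilon>) (C_op D tp K n \<epsilon> u)))"

text \<open>\<open>cl\<close> is the class map of $l^2(\mathbb{Z}^d)$ and \<open>t\<close> the elementary tensor map of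
  $l^2(\mathbb{Z}^d) \otimes \mathcal{H}$. \<open>has_nucleus cl t W \<omega>\<close> says that \<open>W\<close> is the state
  $\widetilde{\omega}$ with nucleus \<open>\<omega>\<close>.\<close>

definition has_nucleus ::
    "((int ^ 'd::finite \<Rightarrow> complex) \<Rightarrow> 'l::chilbert_space) \<Rightarrow>
     ('l \<Rightarrow> 'h::chilbert_space \<Rightarrow> 'k::chilbert_space) \<Rightarrow>
     ('k \<Rightarrow> 'k) \<Rightarrow> (int ^ 'd \<Rightarrow> 'h \<Rightarrow> 'h) \<Rightarrow> bool"
  where "has_nucleus cl t W \<omega> \<longleftrightarrow>
    nucleus \<omega> \<and> density_op W \<and>
    trace_has_sum (\<lambda>x. tensor_op t (ketbra (delta cl x) (delta cl x)) (\<omega> x)) UNIV W"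

definition qbn_state_sequence ::
    "(nat \<Rightarrow> 'h::chilbert_space \<Rightarrow> 'h) \<Rightarrow> (('d::finite \<Rightarrow> 'h) \<Rightarrow> 't::chilbert_space) \<Rightarrow>
     ('t \<Rightarrow> 'h) \<Rightarrow> ((int ^ 'd \<Rightarrow> complex) \<Rightarrow> 'l::chilbert_space) \<Rightarrow>
     ('l \<Rightarrow> 'h \<Rightarrow> 'k::chilbert_space) \<Rightarrow> (nat \<Rightarrow> 'k \<Rightarrow> 'k) \<Rightarrow> bool"
  where "qbn_state_sequence D tp K cl t W \<longleftrightarrow>
    (\<exists>\<omega>. \<forall>n. has_nucleus cl t (W n) (\<omega> n) \<and> \<omega> (Suc n) = J_map D tp K n (\<omega> n))"

definition M_op ::
    "(nat \<Rightarrow> 'h::chilbert_space \<Rightarrow> 'h) \<Rightarrow> (('d::finite \<Rightarrow> 'h) \<Rightarrow> 't::chilbert_space) \<Rightarrow>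
     ('t \<Rightarrow> 'h) \<Rightarrow> ((int ^ 'd \<Rightarrow> complex) \<Rightarrow> 'l::chilbert_space) \<Rightarrow>
     ('l \<Rightarrow> 'h \<Rightarrow> 'k::chilbert_space) \<Rightarrow> nat \<Rightarrow> int ^ 'd \<Rightarrow> int ^ 'd \<Rightarrow> 'k \<Rightarrow> 'k"
  where "M_op D tp K cl t n x y =
    (if x - y \<in> Lambda_d
     then tensor_op t (ketbra (delta cl x) (delta cl y)) (C_op D tp K n (x - y))
     else (\<lambda>_. 0))"

definition M_map ::
    "(nat \<Rightarrow> 'h::chilbert_space \<Rightarrow> 'h) \<Rightarrow> (('d::finite \<Rightarrow> 'h) \<Rightarrow> 't::chilbert_space) \<Rightarrow>
     ('t \<Rightarrow> 'h) \<Rightarrow> ((int ^ 'd \<Rightarrow> complex) \<Rightarrow> 'l::chilbert_space) \<Rightarrow>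
     ('l \<Rightarrow> 'h \<Rightarrow> 'k::chilbert_space) \<Rightarrow> nat \<Rightarrow> ('k \<Rightarrow> 'k) \<Rightarrow> 'k \<Rightarrow> 'k"
  where "M_map D tp K cl t n T =
    trace_infsum
      (\<lambda>(x, y). M_op D tp K cl t n x y \<circ> T \<circ> cadjoint (M_op D tp K cl t n x y))
      UNIV"

end

theory Submission
  imports Defs
begin

text \<open>
Write \<open>V x\<close> for the isometry \<open>v \<mapsto> \<delta>\<^sub>x \<otimes> v\<close>. Its range is the block of the site \<open>x\<close>, blocks of
different sites are orthogonal, and \<open>|\<delta>\<^sub>x\<rangle>\<langle>\<delta>\<^sub>y| \<otimes> C = V x \<circ> C \<circ> (V y)\<^sup>*\<close>
(\<open>tensor_op_ketbra\<close>). So a state with nucleus \<open>\<omega>\<close> is block diagonal, \<open>\<omega>\<close> is recovered from it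
by compression, \<open>(V y)\<^sup>* \<circ> W \<circ> V y = \<omega> y\<close> (\<open>state_compression\<close>), and since the operators
\<open>C \<epsilon>\<close> are self-adjoint (\<open>C_op_bounded_symmetric\<close>) each term of the series for the next state is
\<open>V x \<circ> C (x - y) \<circ> \<omega> y \<circ> C (x - y) \<circ> (V x)\<^sup>*\<close>. For fixed \<open>x\<close> only the finitely many
\<open>y \<in> x - \<Lambda>\<^sup>d\<close> contribute, and their sum is \<open>V x \<circ> \<omega>' x \<circ> (V x)\<^sup>*\<close>, the \<open>x\<close> block of the new
state, where \<open>\<omega>'\<close> is the new nucleus. Summing over \<open>x\<close> gives the new state.

The analytic content is the passage from the iterated sum (over \<open>y\<close>, then over \<open>x\<close>) to the
unconditional double sum in trace norm (\<open>trace_has_sum_refine\<close>). All terms are positive operators,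
so every remainder is, up to sign, a positive operator. The trace norm of a positive operator is
its trace, hence monotone, and the remainder of the double sum is dominated by the remainder of
the block sum as soon as the partial sum contains the corresponding complete blocks.

The trace norm is formulated through \<open>|A|\<close>, so the argument rests on existence and uniqueness of positive
square roots. They come from a norm convergent iteration dominated by a scalar one
(\<open>sqrt_iteration_limit\<close>). The estimate \<open>\<parallel>A v\<parallel> \<le> Tr |A| \<parallel>v\<parallel>\<close> (\<open>norm_le_trace_norm\<close>) turns
trace norm convergence into pointwise convergence, which gives uniqueness of sums and makes
compression and positivity pass to the limit. Square roots also yield the boundedness of tensor
powers of operators (\<open>tensor_power_slot_operator\<close>), without which the operators \<open>C \<epsilon>\<close> would not
be well defined.
\<close>

section \<open>Inner products\<close>

lemma cinner_add_left: "cinner (x + y) z = cinner x z + cinner y z"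
  by (metis cinner_add_right cinner_commute complex_cnj_add)

lemma cinner_scaleC_left: "cinner (a *\<^sub>C x) y = cnj a * cinner x y"
  by (metis cinner_commute cinner_scaleC_right complex_cnj_mult)

lemma cinner_zero_right [simp]: "cinner x 0 = 0"
  using cinner_add_right[of x 0 0] by simp

lemma cinner_zero_left [simp]: "cinner 0 x = 0"
  using cinner_add_left[of 0 0 x] by simp

lemma cinner_minus_right: "cinner x (- y) = - cinner x y"
  using cinner_add_right[of x y "- y"] by (simp add: add_eq_0_iff)

lemma cinner_minus_left: "cinner (- x) y = - cinner x y"
  using cinner_add_left[of x "- x" y] by (simp add: add_eq_0_iff)

lemma cinner_diff_right: "cinner x (y - z) = cinner x y - cinner x z"
  using cinner_add_right[of x y "- z"] by (simp add: cinner_minus_right)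

lemma cinner_diff_left: "cinner (x - y) z = cinner x z - cinner y z"
  using cinner_add_left[of x "- y" z] by (simp add: cinner_minus_left)

lemma cinner_sum_right: "cinner x (\<Sum>i\<in>F. f i) = (\<Sum>i\<in>F. cinner x (f i))"
  by (induction F rule: infinite_finite_induct) (simp_all add: cinner_add_right)

lemma cinner_sum_left: "cinner (\<Sum>i\<in>F. f i) x = (\<Sum>i\<in>F. cinner (f i) x)"
  by (induction F rule: infinite_finite_induct) (simp_all add: cinner_add_left)

lemma cinner_scaleR_right: "cinner x (r *\<^sub>R y) = of_real r * cinner x y"
  by (metis cinner_scaleC_right scaleC_of_real)

lemma cinner_scaleR_left: "cinner (r *\<^sub>R x) y = of_real r * cinner x y"
  by (metis cinner_scaleC_left scaleC_of_real complex_cnj_complex_of_real)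

lemmas cinner_simps = cinner_add_left cinner_add_right cinner_diff_left cinner_diff_right
  cinner_scaleC_left cinner_scaleC_right cinner_minus_left cinner_minus_right

lemma norm_sq_cinner: "(norm x)\<^sup>2 = Re (cinner x x)"
  by (simp add: cinner_self)

lemma norm_scaleC: "norm (a *\<^sub>C x) = cmod a * norm x"
proof -
  have "complex_of_real ((norm (a *\<^sub>C x))\<^sup>2) = (cnj a * a) * cinner x x"
    by (simp add: cinner_self[symmetric] cinner_simps del: of_real_power)
  also have "\<dots> = complex_of_real ((cmod a * norm x)\<^sup>2)"
    by (simp add: cinner_self power_mult_distrib complex_norm_square[symmetric] mult.commute)
  finally have "(norm (a *\<^sub>C x))\<^sup>2 = (cmod a * norm x)\<^sup>2" by (simp only: of_real_eq_iff)
  then show ?thesis by (simp add: power2_eq_iff_nonneg)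
qed

lemma cinner_ext:
  assumes "\<And>z. cinner z x = cinner z y"
  shows "x = y"
proof -
  have "cinner (x - y) (x - y) = 0" using assms[of "x - y"] by (simp add: cinner_diff_right)
  then show ?thesis by (simp add: cinner_self)
qed

section \<open>Bounded operators\<close>

lemma bounded_clinearI:
  assumes "\<And>x y. A (x + y) = A x + A y" "\<And>c x. A (c *\<^sub>C x) = c *\<^sub>C A x"
    "\<And>x. norm (A x) \<le> norm x * M"
  shows "bounded_clinear A"
proof -
  have "A (r *\<^sub>R x) = r *\<^sub>R A x" for r x using assms(2)[of "of_real r" x] by (simp add: scaleC_of_real)
  then show ?thesis unfolding bounded_clinear_def
    using assms by (auto intro!: bounded_linear_intro[where K = M])
qed

lemma bounded_clinear_bl: "bounded_clinear A \<Longrightarrow> bounded_linear A"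
  and bounded_clinear_scaleC: "bounded_clinear A \<Longrightarrow> A (c *\<^sub>C x) = c *\<^sub>C A x"
  by (simp_all add: bounded_clinear_def)

lemma bounded_clinear_add: "bounded_clinear A \<Longrightarrow> A (x + y) = A x + A y"
  and bounded_clinear_diff: "bounded_clinear A \<Longrightarrow> A (x - y) = A x - A y"
  and bounded_clinear_minus: "bounded_clinear A \<Longrightarrow> A (- x) = - A x"
  and bounded_clinear_zero: "bounded_clinear A \<Longrightarrow> A 0 = 0"
  and bounded_clinear_sum: "bounded_clinear A \<Longrightarrow> A (\<Sum>i\<in>F. f i) = (\<Sum>i\<in>F. A (f i))"
  by (auto dest!: bounded_clinear_bl bounded_linear.linear
      simp: linear_add linear_diff linear_neg linear_0 linear_sum)

lemma bounded_clinear_bound: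
  assumes "bounded_clinear A"
  obtains M where "M > 0" "\<And>x. norm (A x) \<le> M * norm x"
  using bounded_linear.pos_bounded[OF bounded_clinear_bl[OF assms]] by (metis mult.commute)

lemma bounded_clinear_id: "bounded_clinear (\<lambda>x. x)"
  by (simp add: bounded_clinear_def)

lemma bounded_clinear_comp:
  "bounded_clinear A \<Longrightarrow> bounded_clinear B \<Longrightarrow> bounded_clinear (\<lambda>x. A (B x))"
  by (simp add: bounded_clinear_def bounded_linear_compose)

lemma bounded_clinear_plus:
  "bounded_clinear A \<Longrightarrow> bounded_clinear B \<Longrightarrow> bounded_clinear (\<lambda>x. A x + B x)"
  by (simp add: bounded_clinear_def bounded_linear_add scaleC_add_right)

lemma bounded_clinear_neg:
  "bounded_clinear A \<Longrightarrow> bounded_clinear (\<lambda>x. - A x)"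
  by (simp add: bounded_clinear_def bounded_linear_minus)

lemma bounded_clinear_minus_op:
  "bounded_clinear A \<Longrightarrow> bounded_clinear B \<Longrightarrow> bounded_clinear (\<lambda>x. A x - B x)"
  using bounded_clinear_plus[OF _ bounded_clinear_neg, of A B] by simp

lemma bounded_clinear_zero_op: "bounded_clinear (\<lambda>_. 0)"
  by (simp add: bounded_clinear_def)

lemma bounded_clinear_sum_op:
  "(\<And>i. i \<in> F \<Longrightarrow> bounded_clinear (A i)) \<Longrightarrow> bounded_clinear (\<lambda>x. \<Sum>i\<in>F. A i x)"
  by (induction F rule: infinite_finite_induct)
    (simp_all add: bounded_clinear_zero_op bounded_clinear_plus)

lemma bounded_clinear_scaled: "bounded_clinear A \<Longrightarrow> bounded_clinear (\<lambda>x. c *\<^sub>C A x)"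
proof -
  assume A: "bounded_clinear A"
  obtain M where M: "\<And>x. norm (A x) \<le> M * norm x"
    using bounded_clinear_bound[OF A] by metis
  have "cmod c * norm (A x) \<le> norm x * (cmod c * M)" for x
    using mult_left_mono[OF M[of x] norm_ge_zero[of c]] by (simp add: mult_ac)
  then show ?thesis
    by (intro bounded_clinearI[where M = "cmod c * M"])
      (simp_all add: bounded_clinear_add[OF A] bounded_clinear_scaleC[OF A] scaleC_add_right
        scaleC_scaleC norm_scaleC mult.commute)
qed

section \<open>Positive operators\<close>

text \<open>Polarization: a quadratic form that takes only real values determines a hermitian form, as one sees
on the vectors \<open>x + y\<close> and \<open>x + \<i> y\<close>.\<close>

lemma positive_op_sym:
  assumes "positive_op P"
  shows "cinner (P x) y = cinner x (P y)"
proof -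
  have P: "bounded_clinear P" and r: "\<And>x. Im (cinner x (P x)) = 0"
    using assms by (auto simp: positive_op_def complex_is_Real_iff)
  have "Im (cinner x (P y)) + Im (cinner y (P x)) = 0"
    using r[of "x + y"] r[of x] r[of y] by (simp add: bounded_clinear_add[OF P] cinner_simps)
  moreover have "Re (cinner x (P y)) - Re (cinner y (P x)) = 0"
    using r[of "x + \<i> *\<^sub>C y"] r[of x] r[of y]
    by (simp add: bounded_clinear_add[OF P] bounded_clinear_scaleC[OF P] cinner_simps)
  ultimately have "cinner x (P y) = cnj (cinner y (P x))" by (simp add: complex_eq_iff)
  then show ?thesis by (metis cinner_commute)
qed

lemma positive_op_nonneg: "positive_op P \<Longrightarrow> 0 \<le> Re (cinner x (P x))"
  and positive_op_bounded: "positive_op P \<Longrightarrow> bounded_clinear P"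
  by (simp_all add: positive_op_def)

lemma positive_opI:
  assumes "bounded_clinear P" "\<And>x y. cinner (P x) y = cinner x (P y)"
    "\<And>x. 0 \<le> Re (cinner x (P x))"
  shows "positive_op P"
proof -
  have "cinner x (P x) \<in> \<real>" for x
    using cinner_commute[of x "P x"] assms(2)[of x x] by (metis Reals_cnj_iff)
  then show ?thesis using assms by (simp add: positive_op_def)
qed

lemma positive_op_id: "positive_op (\<lambda>x. x)"
  by (rule positive_opI) (simp_all add: bounded_clinear_id cinner_self)

text \<open>Stated for the semidefinite form of a positive operator; the identity operator gives the usual
Cauchy-Schwarz inequality. It is the substitute for a square root wherever a positive operator is
controlled by its quadratic form.\<close>

lemma positive_op_cauchy_schwarz:
  assumes P: "positive_op P"
  shows "(cmod (cinner x (P y)))\<^sup>2 \<le> Re (cinner x (P x)) * Re (cinner y (P y))"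
proof -
  define b where "b = cmod (cinner x (P y))"
  \<comment> \<open>The phase \<open>u\<close> makes the mixed term real, so that a real quadratic in \<open>r\<close> remains.\<close>
  define u where "u = (if b = 0 then 1 else cnj (cinner x (P y)) / of_real b)"
  have lin: "bounded_clinear P" using P by (rule positive_op_bounded)
  have u: "cmod u = 1" by (auto simp: u_def b_def norm_divide)
  have ub: "u * cinner x (P y) = of_real b"
  proof (cases "b = 0")
    case False
    then show ?thesis
      by (simp add: u_def) (metis b_def complex_norm_square mult.commute of_real_power
          nonzero_mult_div_cancel_left of_real_eq_0_iff power2_eq_square times_divide_eq_left)
  qed (simp add: b_def)
  define a where "a = Re (cinner x (P x))"
  define c where "c = Re (cinner y (P y))"
  have q: "0 \<le> a + 2 * r * b + r\<^sup>2 * c" for r :: real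
  proof -
    let ?z = "of_real r * u"
    have "cinner y (P x) = cnj (cinner x (P y))"
      using positive_op_sym[OF P, of y x] by (metis cinner_commute)
    then have 1: "cnj u * cinner y (P x) = of_real b" using ub
      by (metis complex_cnj_complex_of_real complex_cnj_mult)
    have uu: "cnj u * u = 1" using u by (metis complex_norm_square mult.commute of_real_1 one_power2)
    have "cinner (x + ?z *\<^sub>C y) (P (x + ?z *\<^sub>C y)) =
       cinner x (P x) + of_real r * (u * cinner x (P y)) + of_real r * (cnj u * cinner y (P x))
        + of_real (r\<^sup>2) * (cnj u * u) * cinner y (P y)"
      by (simp add: bounded_clinear_add[OF lin] bounded_clinear_scaleC[OF lin] cinner_simps
          algebra_simps power2_eq_square)
    also have "\<dots> = cinner x (P x) + 2 * of_real r * of_real b + of_real (r\<^sup>2) * cinner y (P y)"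
      unfolding ub 1 uu by simp
    finally show ?thesis using positive_op_nonneg[OF P, of "x + ?z *\<^sub>C y"]
      by (simp add: a_def c_def)
  qed
  have c0: "0 \<le> c" using positive_op_nonneg[OF P] by (simp add: c_def)
  have "b\<^sup>2 \<le> a * c"
  proof (cases "c = 0")
    case True
    have "b = 0"
    proof (rule ccontr)
      assume "b \<noteq> 0"
      then show False using q[of "- (a + 1) / (2 * b)"] True by (simp add: field_simps)
    qed
    then show ?thesis using True by simp
  next
    case False
    then have "0 \<le> a - b\<^sup>2 / c" using q[of "- b / c"] by (simp add: power2_eq_square)
    then show ?thesis using False c0 by (simp add: field_simps)
  qed
  then show ?thesis by (simp add: a_def b_def c_def)
qed

lemma cinner_cauchy_schwarz: "cmod (cinner x y) \<le> norm x * norm y"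
proof -
  have "(cmod (cinner x y))\<^sup>2 \<le> (norm x * norm y)\<^sup>2"
    using positive_op_cauchy_schwarz[OF positive_op_id, of x y]
    by (simp add: norm_sq_cinner power_mult_distrib)
  then show ?thesis by (simp add: power2_le_iff_abs_le)
qed

lemma bounded_bilinear_cinner: "bounded_bilinear cinner"
proof
  show "\<exists>K. \<forall>a b. norm (cinner a b) \<le> norm a * norm b * K"
    by (rule exI[of _ 1]) (simp add: cinner_cauchy_schwarz)
qed (simp_all add: cinner_simps cinner_scaleR_left cinner_scaleR_right scaleR_conv_of_real)

lemma bounded_bilinear_scaleC: "bounded_bilinear scaleC"
proof
  show "\<exists>K. \<forall>a b. norm (scaleC a b) \<le> norm a * norm b * K"
    by (rule exI[of _ 1]) (simp add: norm_scaleC)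
qed (simp_all add: scaleC_add_left scaleC_add_right scaleC_scaleC scaleR_conv_of_real
    mult.commute flip: scaleC_of_real)

lemmas tendsto_scaleC = bounded_bilinear.tendsto[OF bounded_bilinear_scaleC]

section \<open>Orthogonal projection, Riesz representation and adjoints\<close>

lemma parallelogram: "(norm (x + y))\<^sup>2 + (norm (x - y))\<^sup>2 = 2 * (norm x)\<^sup>2 + 2 * (norm (y::'a::chilbert_space))\<^sup>2"
  by (simp add: norm_sq_cinner cinner_simps)

text \<open>A minimizing sequence is Cauchy by the parallelogram law, because midpoints stay in the subspace
and hence cannot come closer to \<open>x\<close> than the infimum.\<close>

lemma closed_subspace_nearest_point:
  fixes S :: "'a::chilbert_space set"
  assumes S: "complex_vector.subspace S" and cl: "closed S"
  obtains m where "m \<in> S" "\<And>y. y \<in> S \<Longrightarrow> norm (x - m) \<le> norm (x - y)"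
proof -
  define d where "d = (INF y\<in>S. norm (x - y))"
  have ne: "S \<noteq> {}" using complex_vector.subspace_0[OF S] by auto
  have bdd: "bdd_below ((\<lambda>y. norm (x - y)) ` S)" by (rule bdd_belowI[of _ 0]) auto
  have d_le: "d \<le> norm (x - y)" if "y \<in> S" for y
    unfolding d_def using bdd that by (rule cINF_lower)
  have d0: "0 \<le> d" unfolding d_def using ne by (intro cINF_greatest) auto
  have "\<exists>y\<in>S. norm (x - y) < d + 1 / real (Suc n)" for n
    using cINF_less_iff[OF ne bdd, of "d + 1 / real (Suc n)"] by (simp add: d_def)
  then obtain y where yS: "\<And>n. y n \<in> S" and yd: "\<And>n. norm (x - y n) < d + 1 / real (Suc n)"
    by metis
  have key: "(norm (y n - y m))\<^sup>2 \<le> (8 * d + 4) / real (Suc N)" if "N \<le> n" "N \<le> m" for n m N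
  proof -
    let ?e = "1 / real (Suc N)"
    have e: "0 < ?e" "?e \<le> 1" by auto
    have le: "norm (x - y k) \<le> d + ?e" if "N \<le> k" for k
      using yd[of k] that by (smt (verit) frac_le of_nat_0_less_iff of_nat_mono Suc_le_mono zero_less_Suc)
    have sq: "(norm (x - y k))\<^sup>2 \<le> d\<^sup>2 + (2 * d + 1) * ?e" if "N \<le> k" for k
    proof -
      have "(norm (x - y k))\<^sup>2 \<le> (d + ?e)\<^sup>2" using le[OF that] by (rule power_mono) simp
      also have "\<dots> = d\<^sup>2 + 2 * d * ?e + ?e * ?e" by (simp add: power2_eq_square algebra_simps)
      also have "?e * ?e \<le> 1 * ?e" by (rule mult_right_mono) (use e in auto)
      finally show ?thesis by (simp add: algebra_simps)
    qed
    have mid: "(1/2) *\<^sub>C (y n + y m) \<in> S"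
      using S yS by (intro complex_vector.subspace_scale complex_vector.subspace_add)
    have "(x - y n) + (x - y m) = 2 *\<^sub>R (x - (1/2) *\<^sub>C (y n + y m))"
      using scaleC_of_real[of "1/2" "y n + y m"]
      by (simp add: algebra_simps scaleR_2)
    then have "norm ((x - y n) + (x - y m)) \<ge> 2 * d" using d_le[OF mid] by simp
    then have "(norm ((x - y n) + (x - y m)))\<^sup>2 \<ge> (2 * d)\<^sup>2" using d0 by (intro power_mono) auto
    moreover have "norm ((x - y n) - (x - y m)) = norm (y n - y m)"
      by (simp add: norm_minus_commute)
    ultimately have "(norm (y n - y m))\<^sup>2 \<le> 2 * (norm (x - y n))\<^sup>2 + 2 * (norm (x - y m))\<^sup>2 - 4 * d\<^sup>2"
      using parallelogram[of "x - y n" "x - y m"] by (simp add: power_mult_distrib)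
    also have "\<dots> \<le> 4 * ((2 * d + 1) * ?e)" using sq[OF that(1)] sq[OF that(2)] by linarith
    finally show ?thesis by (simp add: algebra_simps add_divide_distrib)
  qed
  have "Cauchy y"
  proof (rule metric_CauchyI)
    fix e :: real assume e: "0 < e"
    obtain N where N: "(8 * d + 4) / e\<^sup>2 < real N" using reals_Archimedean2 by blast
    have "dist (y m) (y n) < e" if "N \<le> m" "N \<le> n" for m n
    proof -
      have "(8 * d + 4) / e\<^sup>2 < real (Suc N)" using N by simp
      then have "(8 * d + 4) / real (Suc N) < e\<^sup>2" using e
        by (simp add: field_simps del: of_nat_Suc)
      then have "(norm (y m - y n))\<^sup>2 < e\<^sup>2" using key[OF that] by linarith
      then show ?thesis using e by (simp add: dist_norm power2_less_imp_less)
    qed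
    then show "\<exists>M. \<forall>m\<ge>M. \<forall>n\<ge>M. dist (y m) (y n) < e" by blast
  qed
  then obtain m where m: "y \<longlonglongrightarrow> m" using Cauchy_convergent convergent_def by blast
  have "m \<in> S" using closed_sequentially[OF cl _ m] yS by blast
  moreover have "norm (x - m) \<le> d"
  proof (rule LIMSEQ_le)
    show "(\<lambda>n. norm (x - y n)) \<longlonglongrightarrow> norm (x - m)" using m by (intro tendsto_intros)
    show "(\<lambda>n. d + 1 / real (Suc n)) \<longlonglongrightarrow> d"
      using tendsto_add[OF tendsto_const LIMSEQ_inverse_real_of_nat, of d] by (simp add: inverse_eq_divide)
    show "\<exists>N. \<forall>n\<ge>N. norm (x - y n) \<le> d + 1 / real (Suc n)" using yd less_imp_le by blast
  qed
  ultimately show ?thesis using that d_le by force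
qed

text \<open>First variation at the nearest point \<open>m\<close>, with \<open>w = x - m\<close>: adding a small positive multiple of
\<open>cinner y w *\<^sub>C y\<close> to \<open>m\<close> would decrease the distance to \<open>x\<close> unless \<open>cinner y w\<close> vanishes.\<close>

lemma orthogonal_projection:
  fixes S :: "'a::chilbert_space set"
  assumes S: "complex_vector.subspace S" and cl: "closed S"
  obtains m where "m \<in> S" "\<And>y. y \<in> S \<Longrightarrow> cinner y (x - m) = 0"
proof -
  obtain m where mS: "m \<in> S" and m: "\<And>y. y \<in> S \<Longrightarrow> norm (x - m) \<le> norm (x - y)"
    using closed_subspace_nearest_point[OF assms] by metis
  have "cinner y (x - m) = 0" if y: "y \<in> S" for y
  proof -
    define w where "w = x - m"
    define b where "b = cinner y w"
    \<comment> \<open>A step so small that the quadratic term cannot outweigh the linear one.\<close>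
    define s where "s = 1 / ((norm y)\<^sup>2 + 1)"
    have s: "0 < s" "s * (norm y)\<^sup>2 < 1" by (auto simp: s_def field_simps add_pos_nonneg)
    have "norm w \<le> norm (x - (m + (of_real s * b) *\<^sub>C y))" unfolding w_def
      by (intro m complex_vector.subspace_add[OF S] complex_vector.subspace_scale[OF S] mS y)
    then have "(norm w)\<^sup>2 \<le> (norm (w - (of_real s * b) *\<^sub>C y))\<^sup>2"
      by (intro power_mono) (auto simp: w_def diff_diff_eq)
    also have "\<dots> = Re (cinner w w) - 2 * s * (cmod b)\<^sup>2 + s\<^sup>2 * (cmod b)\<^sup>2 * (norm y)\<^sup>2"
    proof -
      have "cinner w y = cnj b" unfolding b_def by (rule cinner_commute)
      then have "cinner (w - (of_real s * b) *\<^sub>C y) (w - (of_real s * b) *\<^sub>C y)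
         = cinner w w - of_real (2 * s) * (b * cnj b) + of_real (s\<^sup>2) * (b * cnj b) * cinner y y"
        by (simp add: cinner_simps b_def[symmetric] algebra_simps power2_eq_square)
      also have "\<dots> = cinner w w - of_real (2 * s * (cmod b)\<^sup>2) + of_real (s\<^sup>2 * (cmod b)\<^sup>2 * (norm y)\<^sup>2)"
        by (simp add: cinner_self flip: complex_norm_square)
      finally have "Re (cinner (w - (of_real s * b) *\<^sub>C y) (w - (of_real s * b) *\<^sub>C y))
         = Re (cinner w w - of_real (2 * s * (cmod b)\<^sup>2) + of_real (s\<^sup>2 * (cmod b)\<^sup>2 * (norm y)\<^sup>2))"
        by (rule arg_cong)
      then show ?thesis
        by (simp only: norm_sq_cinner[symmetric] plus_complex.simps minus_complex.simps Re_complex_of_real)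
    qed
    finally have "2 * s * (cmod b)\<^sup>2 \<le> s * (cmod b)\<^sup>2 * (s * (norm y)\<^sup>2)"
      by (simp add: norm_sq_cinner[of w, symmetric]) (simp add: power2_eq_square mult_ac)
    also have "\<dots> \<le> s * (cmod b)\<^sup>2 * 1" using s by (intro mult_left_mono) auto
    finally have "s * (cmod b)\<^sup>2 \<le> 0" by simp
    then have "b = 0" using s by (simp add: mult_le_0_iff)
    then show ?thesis by (simp add: b_def w_def)
  qed
  then show ?thesis using that mS by blast
qed

text \<open>A vector orthogonal to the kernel represents the functional up to a scalar.\<close>

lemma riesz_representation:
  assumes f: "bounded_clinear (f :: 'a::chilbert_space \<Rightarrow> complex)"
  shows "\<exists>z. \<forall>x. f x = cinner z x"
proof (cases "\<forall>x. f x = 0")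
  case True
  then show ?thesis by (intro exI[of _ 0]) simp
next
  case False
  then obtain x0 where x0: "f x0 \<noteq> 0" by blast
  have sub: "complex_vector.subspace {x. f x = 0}"
    using f by (auto simp: complex_vector.subspace_def bounded_clinear_zero bounded_clinear_add
        bounded_clinear_scaleC scaleC_complex_def)
  have cl: "closed {x. f x = 0}"
    using f by (intro closed_Collect_eq linear_continuous_on bounded_clinear_bl continuous_on_const)
  obtain m where m: "f m = 0" "\<And>y. f y = 0 \<Longrightarrow> cinner y (x0 - m) = 0"
    using orthogonal_projection[OF sub cl, of x0] by auto
  define w where "w = x0 - m"
  have fw: "f w \<noteq> 0" using x0 m f by (simp add: w_def bounded_clinear_diff)
  then have w0: "cinner w w \<noteq> 0" using f by (auto simp: cinner_self bounded_clinear_zero)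
  have "f x = cinner ((cnj (f w) / cinner w w) *\<^sub>C w) x" for x
  proof -
    have "f (x - (f x / f w) *\<^sub>C w) = 0"
      using f fw by (simp add: bounded_clinear_diff bounded_clinear_scaleC scaleC_complex_def)
    then have "cinner w (x - (f x / f w) *\<^sub>C w) = 0"
      using m(2) cinner_commute unfolding w_def by (metis complex_cnj_zero)
    then have 1: "cinner w x = f x / f w * cinner w w" by (simp add: cinner_simps)
    have "cnj (cinner w w) = cinner w w" by (metis cinner_commute)
    then show ?thesis using fw w0 by (simp add: cinner_scaleC_left 1)
  qed
  then show ?thesis by blast
qed

lemma cadjoint_eqI:
  assumes "\<And>x y. cinner (B y) x = cinner y (A x)"
  shows "cadjoint A = B"
  unfolding cadjoint_def
proof (rule the_equality)
  show "\<forall>x y. cinner (B y) x = cinner y (A x)" using assms by blast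
  show "B' = B" if "\<forall>x y. cinner (B' y) x = cinner y (A x)" for B'
  proof
    show "B' y = B y" for y
      by (rule cinner_ext) (metis that assms cinner_commute)
  qed
qed

lemma cadjoint_cinner:
  assumes A: "bounded_clinear A"
  shows "cinner (cadjoint A y) x = cinner y (A x)"
proof -
  have "\<exists>z. \<forall>x. cinner y (A x) = cinner z x" for y
  proof (rule riesz_representation)
    obtain M where M: "M > 0" "\<And>x. norm (A x) \<le> M * norm x"
      using bounded_clinear_bound[OF A] by metis
    show "bounded_clinear (\<lambda>x. cinner y (A x))"
    proof (rule bounded_clinearI)
      fix x
      have "norm (cinner y (A x)) \<le> norm y * norm (A x)" by (rule cinner_cauchy_schwarz)
      also have "\<dots> \<le> norm y * (M * norm x)" by (intro mult_left_mono M) simp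
      finally show "norm (cinner y (A x)) \<le> norm x * (norm y * M)" by (simp add: mult_ac)
    qed (simp_all add: bounded_clinear_add[OF A] bounded_clinear_scaleC[OF A] cinner_simps
        scaleC_complex_def)
  qed
  then obtain B where "\<And>x y. cinner (B y) x = cinner y (A x)" by metis
  then show ?thesis using cadjoint_eqI by metis
qed

lemma cadjoint_cinner_right:
  "bounded_clinear A \<Longrightarrow> cinner x (cadjoint A y) = cinner (A x) y"
  by (metis cadjoint_cinner cinner_commute)

lemma norm_cadjoint_le:
  assumes A: "bounded_clinear A" and M0: "0 \<le> M" and M: "\<And>x. norm (A x) \<le> M * norm x"
  shows "norm (cadjoint A y) \<le> M * norm y"
proof (cases "cadjoint A y = 0")
  case True
  then show ?thesis using M0 by simp
next
  case False
  let ?z = "cadjoint A y"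
  have "norm ?z * norm ?z = cmod (cinner ?z ?z)" by (simp add: cinner_self power2_eq_square norm_mult)
  also have "\<dots> = cmod (cinner y (A ?z))" by (simp add: cadjoint_cinner[OF A])
  also have "\<dots> \<le> norm y * norm (A ?z)" by (rule cinner_cauchy_schwarz)
  also have "\<dots> \<le> norm y * (M * norm ?z)" by (intro mult_left_mono M) simp
  finally show ?thesis using False by (simp add: mult_ac)
qed

lemma bounded_clinear_cadjoint:
  assumes A: "bounded_clinear A"
  shows "bounded_clinear (cadjoint A)"
proof -
  obtain M where M: "M > 0" "\<And>x. norm (A x) \<le> M * norm x"
    using bounded_clinear_bound[OF A] by metis
  show ?thesis
  proof (rule bounded_clinearI)
    show "cadjoint A (x + y) = cadjoint A x + cadjoint A y" for x y
      by (rule cinner_ext) (simp add: cadjoint_cinner_right[OF A] cinner_simps)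
    show "cadjoint A (c *\<^sub>C x) = c *\<^sub>C cadjoint A x" for c x
      by (rule cinner_ext) (simp add: cadjoint_cinner_right[OF A] cinner_simps)
    show "norm (cadjoint A x) \<le> norm x * M" for x
      using norm_cadjoint_le[OF A less_imp_le[OF M(1)] M(2)] by (simp add: mult.commute)
  qed
qed

section \<open>Total sets and orthonormal bases\<close>

lemma closure_subspace:
  assumes S: "complex_vector.subspace S"
  shows "complex_vector.subspace (closure S)"
  unfolding complex_vector.subspace_def
proof (intro conjI ballI allI)
  show "0 \<in> closure S" using complex_vector.subspace_0[OF S] closure_subset by blast
  fix x assume "x \<in> closure S"
  then obtain f where f: "\<And>n. f n \<in> S" "f \<longlonglongrightarrow> x" by (auto simp: closure_sequential)
  show "c *\<^sub>C x \<in> closure S" for c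
    unfolding closure_sequential
    using f by (intro exI[of _ "\<lambda>n. c *\<^sub>C f n"])
      (auto intro!: complex_vector.subspace_scale[OF S] tendsto_scaleC tendsto_const)
  fix y assume "y \<in> closure S"
  then obtain g where g: "\<And>n. g n \<in> S" "g \<longlonglongrightarrow> y" by (auto simp: closure_sequential)
  show "x + y \<in> closure S"
    unfolding closure_sequential
    using f g by (intro exI[of _ "\<lambda>n. f n + g n"])
      (auto intro!: complex_vector.subspace_add[OF S] tendsto_add)
qed

text \<open>Used as an induction principle: a property that defines a closed subspace holds everywhere once it
holds on a total set.\<close>

lemma closed_subspace_total:
  assumes "closure (cspan E) = UNIV" "complex_vector.subspace S" "closed S" "E \<subseteq> S"
  shows "S = UNIV"
proof -
  have "cspan E \<subseteq> S" using assms(4,2) by (rule complex_vector.span_minimal)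
  then show ?thesis using assms(1,3) by (metis closure_minimal top.extremum_uniqueI)
qed

lemma bounded_clinear_eq_on_total:
  assumes E: "closure (cspan E) = UNIV" and A: "bounded_clinear A" and B: "bounded_clinear B"
    and eq: "\<And>x. x \<in> E \<Longrightarrow> A x = B x"
  shows "A = B"
proof -
  have "{x. A x = B x} = UNIV"
  proof (rule closed_subspace_total[OF E])
    show "complex_vector.subspace {x. A x = B x}"
      using A B by (auto simp: complex_vector.subspace_def bounded_clinear_zero bounded_clinear_add
        bounded_clinear_scaleC)
    show "closed {x. A x = B x}"
      by (intro closed_Collect_eq linear_continuous_on bounded_clinear_bl A B)
  qed (use eq in auto)
  then show ?thesis by auto
qed

text \<open>A maximal orthonormal set is total, since otherwise a unit vector orthogonal to its closed span
could be added. Without a basis the fixed choice \<open>some_onb\<close> would be meaningless.\<close>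

lemma onb_exists: "\<exists>E :: 'a::chilbert_space set. is_onb E"
proof -
  define orth where "orth = {E :: 'a set. \<forall>e\<in>E. \<forall>f\<in>E. cinner e f = (if e = f then 1 else 0)}"
  have "\<exists>M\<in>orth. \<forall>X\<in>orth. M \<subseteq> X \<longrightarrow> X = M"
  proof (rule subset_Zorn)
    fix C assume C: "subset.chain orth C"
    have "\<Union>C \<in> orth" unfolding orth_def
    proof (intro CollectI ballI)
      fix e f assume "e \<in> \<Union>C" "f \<in> \<Union>C"
      then obtain X Y where XY: "X \<in> C" "Y \<in> C" "e \<in> X" "f \<in> Y" by blast
      then have "X \<subseteq> Y \<or> Y \<subseteq> X" using C unfolding subset.chain_def by blast
      then obtain X where "X \<in> C" "e \<in> X" "f \<in> X" using XY by blast
      then show "cinner e f = (if e = f then 1 else 0)"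
        using C unfolding subset.chain_def orth_def by blast
    qed
    then show "\<exists>U\<in>orth. \<forall>X\<in>C. X \<subseteq> U" by blast
  qed
  then obtain E where E: "E \<in> orth" and mx: "\<And>X. X \<in> orth \<Longrightarrow> E \<subseteq> X \<Longrightarrow> X = E" by blast
  have "closure (cspan E) = UNIV"
  proof (rule ccontr)
    assume "closure (cspan E) \<noteq> UNIV"
    then obtain x where x: "x \<notin> closure (cspan E)" by blast
    obtain m where m: "m \<in> closure (cspan E)" "\<And>y. y \<in> closure (cspan E) \<Longrightarrow> cinner y (x - m) = 0"
      using orthogonal_projection[OF closure_subspace[OF complex_vector.subspace_span] closed_closure]
      by metis
    define w where "w = (1 / of_real (norm (x - m))) *\<^sub>C (x - m)"
    have "x \<noteq> m" using x m by blast
    then have "norm w = 1" by (simp add: w_def norm_scaleC norm_divide)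
    then have w1: "cinner w w = 1" by (simp add: cinner_self)
    have wE: "cinner e w = 0" if "e \<in> E" for e
      using m(2)[of e] that complex_vector.span_base[of e E] closure_subset[of "cspan E"]
      by (auto simp: w_def cinner_scaleC_right)
    have wE': "cinner w e = 0" if "e \<in> E" for e
      using wE[OF that] by (metis cinner_commute complex_cnj_zero)
    have "w \<notin> E" using wE[of w] w1 by auto
    then have "insert w E \<in> orth" using E w1 wE wE' unfolding orth_def by auto
    then have "w \<in> E" using mx by blast
    then show False using wE w1 by force
  qed
  then show ?thesis using E unfolding is_onb_def orth_def by blast
qed

lemma some_onb: "is_onb some_onb"
  unfolding some_onb_def using onb_exists by (rule someI_ex)

section \<open>Square roots of operators\<close>

text \<open>Writing \<open>P = I - X\<close>, the equation \<open>P\<^sup>2 = I - B\<close> becomes the fixed point equation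
\<open>X = (B + X\<^sup>2) / 2\<close>. Its iterates from \<open>0\<close> have increments bounded by those of the scalar
iteration \<open>s \<mapsto> (1 + s\<^sup>2) / 2\<close>, which increases and stays below \<open>1\<close>; hence they converge in norm. The
last conclusion records that the limit inherits every closed property preserved by the iteration;
symmetry, complex linearity and commutation relations are all obtained from it.\<close>

lemma sqrt_iteration_limit:
  fixes B :: "'a::banach \<Rightarrow>\<^sub>L 'a"
  assumes B: "norm B \<le> 1"
  obtains L where "norm L \<le> 1" "L = (1/2) *\<^sub>R (B + (L o\<^sub>L L))"
    "\<And>S. closed S \<Longrightarrow> 0 \<in> S \<Longrightarrow> (\<And>X. X \<in> S \<Longrightarrow> (1/2) *\<^sub>R (B + (X o\<^sub>L X)) \<in> S) \<Longrightarrow> L \<in> S"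
proof -
  define step where "step X = (1/2) *\<^sub>R (B + (X o\<^sub>L X))" for X
  define Y where "Y n = (step ^^ n) 0" for n
  define y where "y n = ((\<lambda>s. (1 + s\<^sup>2) / 2) ^^ n) (0::real)" for n
  have Y_Suc: "Y (Suc n) = step (Y n)" and y_Suc: "y (Suc n) = (1 + (y n)\<^sup>2) / 2" for n
    by (simp_all add: Y_def y_def)
  have Y0: "Y 0 = 0" and y0: "y 0 = 0" by (simp_all add: Y_def y_def)
  have y_bounds: "0 \<le> y n \<and> y n \<le> 1" for n
  proof (induction n)
    case (Suc n)
    then have "(y n)\<^sup>2 \<le> 1\<^sup>2" by (intro power_mono) auto
    then show ?case by (simp add: y_Suc)
  qed (simp add: y0)
  have Yy: "norm (Y n) \<le> y n" for n
  proof (induction n)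
    case (Suc n)
    have "norm (Y (Suc n)) \<le> (1/2) * (norm B + norm (Y n o\<^sub>L Y n))"
      by (simp add: Y_Suc step_def norm_triangle_ineq)
    also have "norm (Y n o\<^sub>L Y n) \<le> norm (Y n) * norm (Y n)" by (rule norm_blinfun_compose)
    also have "\<dots> \<le> (y n)\<^sup>2" unfolding power2_eq_square
      using Suc y_bounds by (intro mult_mono) auto
    finally show ?case using B by (simp add: y_Suc)
  qed (simp add: Y0 y0)
  have incr: "norm (Y (Suc n) - Y n) \<le> y (Suc n) - y n" for n
  proof (induction n)
    case 0
    have "norm (Y (Suc 0)) \<le> y (Suc 0)" by (rule Yy)
    then show ?case by (simp add: Y0 y0)
  next
    case (Suc n)
    let ?X = "Y (Suc n)" and ?Z = "Y n"
    have "Y (Suc (Suc n)) - ?X = step ?X - step ?Z" by (simp only: Y_Suc)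
    \<comment> \<open>The splitting \<open>X\<^sup>2 - Z\<^sup>2 = X (X - Z) + (X - Z) Z\<close> is estimated against
      \<open>a\<^sup>2 - b\<^sup>2 = a (a - b) + (a - b) b\<close> term by term.\<close>
    also have "\<dots> = (1/2) *\<^sub>R ((?X o\<^sub>L (?X - ?Z)) + ((?X - ?Z) o\<^sub>L ?Z))"
      unfolding step_def
      by (rule blinfun_eqI) (simp add: blinfun.add_left blinfun.diff_left blinfun.diff_right
          blinfun.scaleR_left algebra_simps)
    finally have "norm (Y (Suc (Suc n)) - ?X) \<le>
        (1/2) * (norm (?X o\<^sub>L (?X - ?Z)) + norm ((?X - ?Z) o\<^sub>L ?Z))"
      by (simp add: norm_triangle_ineq)
    also have "\<dots> \<le> (1/2) * (norm ?X * norm (?X - ?Z) + norm (?X - ?Z) * norm ?Z)"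
      by (intro mult_left_mono add_mono norm_blinfun_compose) simp
    also have "\<dots> \<le> (1/2) * (y (Suc n) * (y (Suc n) - y n) + (y (Suc n) - y n) * y n)"
      using Suc Yy y_bounds order_trans[OF norm_ge_zero Suc]
      by (intro mult_left_mono add_mono mult_mono) auto
    also have "\<dots> = y (Suc (Suc n)) - y (Suc n)"
    proof -
      have "(1/2) * (y (Suc n) * (y (Suc n) - y n) + (y (Suc n) - y n) * y n)
          = (1 + (y (Suc n))\<^sup>2) / 2 - (1 + (y n)\<^sup>2) / 2"
        by (simp add: power2_eq_square field_simps)
      also have "\<dots> = y (Suc (Suc n)) - y (Suc n)" by (simp only: y_Suc)
      finally show ?thesis .
    qed
    finally show ?case .
  qed
  have diff: "norm (Y (n + k) - Y n) \<le> y (n + k) - y n" for n k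
  proof (induction k)
    case (Suc k)
    have "norm (Y (n + Suc k) - Y n) \<le> norm (Y (Suc (n + k)) - Y (n + k)) + norm (Y (n + k) - Y n)"
      using norm_triangle_ineq[of "Y (Suc (n + k)) - Y (n + k)" "Y (n + k) - Y n"] by simp
    then show ?case using incr[of "n + k"] Suc by simp
  qed simp
  have "incseq y" unfolding incseq_Suc_iff using incr by (smt (verit) norm_ge_zero)
  then obtain l where "y \<longlonglongrightarrow> l" using incseq_convergent[of y 1] y_bounds by metis
  then have Cy: "Cauchy y" by (rule LIMSEQ_imp_Cauchy)
  have "Cauchy Y"
  proof (rule metric_CauchyI)
    fix e :: real assume "0 < e"
    then obtain M where M: "\<And>m n. m \<ge> M \<Longrightarrow> n \<ge> M \<Longrightarrow> dist (y m) (y n) < e"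
      using Cy unfolding Cauchy_def by blast
    have le: "dist (Y m) (Y n) < e" if "M \<le> n" "n \<le> m" for m n
      using diff[of n "m - n"] M[of m n] that by (auto simp: dist_norm)
    have "dist (Y m) (Y n) < e" if "m \<ge> M" "n \<ge> M" for m n
      using le[of n m] le[of m n] that by (cases "n \<le> m") (auto simp: dist_commute)
    then show "\<exists>M. \<forall>m\<ge>M. \<forall>n\<ge>M. dist (Y m) (Y n) < e" by blast
  qed
  then obtain L where L: "Y \<longlonglongrightarrow> L" using Cauchy_convergent convergent_def by blast
  have 1: "norm L \<le> 1"
    using tendsto_norm[OF L] by (rule LIMSEQ_le_const2) (use Yy y_bounds order_trans in blast)
  have "(\<lambda>n. step (Y n)) \<longlonglongrightarrow> step L" unfolding step_def
    by (intro tendsto_scaleR tendsto_add tendsto_const L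
        bounded_bilinear.tendsto[OF bounded_bilinear_blinfun_compose])
  then have "(\<lambda>n. Y (Suc n)) \<longlonglongrightarrow> step L" by (simp add: Y_Suc)
  then have 2: "L = step L" using LIMSEQ_unique[OF LIMSEQ_Suc[OF L]] by blast
  have 3: "L \<in> S" if "closed S" "0 \<in> S" "\<And>X. X \<in> S \<Longrightarrow> step X \<in> S" for S
  proof -
    have "Y n \<in> S" for n by (induction n) (simp_all add: Y0 Y_Suc that)
    then show ?thesis using closed_sequentially[OF that(1) _ L] by blast
  qed
  show ?thesis using that[of L] 1 2 3 unfolding step_def by blast
qed

text \<open>The root is \<open>I - L\<close> with \<open>L\<close> the limit of the iteration; it is positive because \<open>L\<close> is a symmetric
contraction. It commutes with everything that commutes with \<open>B\<close>, being a limit of polynomials in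
\<open>B\<close>; this is what uniqueness of roots relies on.\<close>

lemma sqrt_id_minus_exists:
  fixes B :: "'a::chilbert_space \<Rightarrow> 'a"
  assumes B: "bounded_clinear B" and sym: "\<And>x y. cinner (B x) y = cinner x (B y)"
    and contr: "\<And>x. norm (B x) \<le> norm x"
  obtains P where "positive_op P" "\<And>x. P (P x) = x - B x"
    "\<And>T x. bounded_linear T \<Longrightarrow> (\<And>x. T (B x) = B (T x)) \<Longrightarrow> T (P x) = P (T x)"
proof -
  define Bb where "Bb = Blinfun B"
  have Bb: "blinfun_apply Bb x = B x" for x
    unfolding Bb_def by (rule bounded_linear_Blinfun_apply[THEN fun_cong], rule bounded_clinear_bl[OF B])
  have "norm Bb \<le> 1" by (rule norm_blinfun_bound) (simp_all add: Bb contr)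
  then obtain L where L1: "norm L \<le> 1" and L: "L = (1/2) *\<^sub>R (Bb + (L o\<^sub>L L))"
    and ind: "\<And>S. closed S \<Longrightarrow> 0 \<in> S \<Longrightarrow> (\<And>X. X \<in> S \<Longrightarrow> (1/2) *\<^sub>R (Bb + (X o\<^sub>L X)) \<in> S) \<Longrightarrow> L \<in> S"
    using sqrt_iteration_limit by metis
  have cont: "continuous_on UNIV (\<lambda>X :: 'a \<Rightarrow>\<^sub>L 'a. X x)" for x
    by (intro continuous_intros)
  have comm: "T (L x) = L (T x)" if T: "bounded_linear T" and TB: "\<And>x. T (B x) = B (T x)" for T x
  proof -
    interpret T: bounded_linear T by (rule T)
    have "L \<in> {X. \<forall>x. T (blinfun_apply X x) = X (T x)}"
    proof (rule ind)
      show "closed {X. \<forall>x. T (blinfun_apply X x) = X (T x)}"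
        by (intro closed_Collect_all closed_Collect_eq T.continuous_on cont)
    qed (simp_all add: blinfun.add_left blinfun.scaleR_left T.add T.scaleR T.zero Bb TB)
    then show ?thesis by simp
  qed
  \<comment> \<open>The iteration lives among real linear maps; complex linearity of the limit is commutation with
    complex scalars.\<close>
  have sc: "bounded_linear (\<lambda>x::'a. c *\<^sub>C x)" for c
    using bounded_clinear_bl[OF bounded_clinear_scaled[OF bounded_clinear_id]] .
  have Lsc: "L (c *\<^sub>C x) = c *\<^sub>C L x" for c x
    using comm[OF sc, of c x] bounded_clinear_scaleC[OF B] by simp
  have "L \<in> {X. \<forall>x y. cinner (blinfun_apply X x) y = cinner x (X y)}"
  proof (rule ind)
    show "closed {X :: 'a \<Rightarrow>\<^sub>L 'a. \<forall>x y. cinner (blinfun_apply X x) y = cinner x (X y)}"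
      by (intro closed_Collect_all closed_Collect_eq cont continuous_on_const
          bounded_bilinear.continuous_on[OF bounded_bilinear_cinner])
  qed (simp_all add: blinfun.add_left blinfun.scaleR_left cinner_simps cinner_scaleR_left
      cinner_scaleR_right Bb sym)
  then have Lsym: "cinner (L x) y = cinner x (L y)" for x y by simp
  have Ln: "norm (L x) \<le> norm x" for x
    using norm_blinfun[of L x] mult_right_mono[OF L1 norm_ge_zero[of x]] by simp
  have Lc: "bounded_clinear (blinfun_apply L)"
    by (simp add: bounded_clinear_def blinfun.bounded_linear_right Lsc)
  define P where "P x = x - L x" for x
  have LL: "2 *\<^sub>R L x = B x + L (L x)" for x
  proof -
    have "L x = ((1/2) *\<^sub>R (Bb + (L o\<^sub>L L))) x" using L by (rule arg_cong)
    then have "L x = (1/2) *\<^sub>R (B x + L (L x))" by (simp add: blinfun.add_left blinfun.scaleR_left Bb)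
    then have "2 *\<^sub>R L x = 2 *\<^sub>R ((1/2) *\<^sub>R (B x + L (L x)))" by (rule arg_cong)
    then show ?thesis by simp
  qed
  have 1: "positive_op P"
  proof (rule positive_opI)
    show "bounded_clinear P" unfolding P_def by (rule bounded_clinear_minus_op[OF bounded_clinear_id Lc])
    show "cinner (P x) y = cinner x (P y)" for x y by (simp add: P_def cinner_simps Lsym)
    show "0 \<le> Re (cinner x (P x))" for x
    proof -
      have "Re (cinner x (L x)) \<le> norm x * norm (L x)"
        using complex_Re_le_cmod cinner_cauchy_schwarz order_trans by blast
      also have "\<dots> \<le> (norm x)\<^sup>2" unfolding power2_eq_square by (intro mult_left_mono Ln) simp
      finally show ?thesis by (simp add: P_def cinner_simps norm_sq_cinner)
    qed
  qed
  have 2: "P (P x) = x - B x" for x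
    using LL[of x] by (simp add: P_def blinfun.diff_right scaleR_2 algebra_simps)
  have 3: "T (P x) = P (T x)" if "bounded_linear T" "\<And>x. T (B x) = B (T x)" for T x
    using comm[OF that] linear_diff[OF bounded_linear.linear[OF that(1)]] by (simp add: P_def)
  show ?thesis using that[of P] 1 2 3 by blast
qed

text \<open>The defect operator of \<open>A / M\<close>, that is \<open>T = (I - A\<^sup>* A / M\<^sup>2)\<^sup>1\<^sup>/\<^sup>2\<close>: it turns the bound
\<open>\<parallel>A x\<parallel> \<le> M \<parallel>x\<parallel>\<close> into an identity between inner products, which, unlike the bound, survives
multiplication by further factors and summation.\<close>

lemma contraction_defect_exists:
  assumes A: "bounded_clinear A" and M: "0 < M" "\<And>x. norm (A x) \<le> M * norm x"
  obtains T where "positive_op T"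
    "\<And>x y. cinner (A x) (A y) + (of_real (M\<^sup>2)) * cinner (T x) (T y) = of_real (M\<^sup>2) * cinner x y"
proof -
  define B where "B x = (1 / of_real (M\<^sup>2)) *\<^sub>C cadjoint A (A x)" for x
  have Bc: "bounded_clinear B" unfolding B_def
    by (intro bounded_clinear_scaled bounded_clinear_comp[OF bounded_clinear_cadjoint[OF A] A])
  have nB: "norm (B x) \<le> norm x" for x
  proof -
    have "norm (cadjoint A (A x)) \<le> M * norm (A x)" using A M by (intro norm_cadjoint_le) auto
    also have "\<dots> \<le> M * (M * norm x)" using M by (intro mult_left_mono) auto
    finally have "norm (cadjoint A (A x)) \<le> M\<^sup>2 * norm x" by (simp add: power2_eq_square mult.assoc)
    moreover have "norm (B x) = norm (cadjoint A (A x)) / M\<^sup>2"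
      by (simp add: B_def norm_scaleC norm_divide norm_power)
    ultimately show ?thesis using M by (simp add: divide_le_eq mult.commute)
  qed
  have Bs: "cinner (B x) y = cinner x (B y)" for x y
    by (simp add: B_def cinner_simps cadjoint_cinner[OF A] cadjoint_cinner_right[OF A])
  obtain T where T: "positive_op T" "\<And>x. T (T x) = x - B x"
    using sqrt_id_minus_exists[OF Bc Bs nB] by metis
  have "cinner (A x) (A y) + (of_real (M\<^sup>2)) * cinner (T x) (T y) = of_real (M\<^sup>2) * cinner x y" for x y
    using M by (simp add: positive_op_sym[OF T(1)] T(2) cinner_simps B_def cadjoint_cinner_right[OF A]
        algebra_simps)
  then show ?thesis using that T(1) by blast
qed

text \<open>Scaling by \<open>M\<close> brings \<open>A\<^sup>* A\<close> into the form \<open>M\<^sup>2 (I - B)\<close> with a contraction \<open>B\<close>.\<close>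

lemma sqrt_cadjoint_comp_exists:
  assumes A: "bounded_clinear A"
  obtains P where "positive_op P" "\<And>x. P (P x) = cadjoint A (A x)"
    "\<And>T x. bounded_clinear T \<Longrightarrow> (\<And>x. T (cadjoint A (A x)) = cadjoint A (A (T x))) \<Longrightarrow> T (P x) = P (T x)"
proof -
  obtain M where M: "M > 0" "\<And>x. norm (A x) \<le> M * norm x"
    using bounded_clinear_bound[OF A] by metis
  define G where "G x = cadjoint A (A x)" for x
  define B where "B x = x - (1 / of_real (M\<^sup>2)) *\<^sub>C G x" for x
  have Gc: "bounded_clinear G" unfolding G_def
    by (rule bounded_clinear_comp[OF bounded_clinear_cadjoint[OF A] A])
  have Bc: "bounded_clinear B" unfolding B_def
    by (intro bounded_clinear_minus_op bounded_clinear_id bounded_clinear_scaled Gc)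
  have Gs: "cinner (G x) y = cinner x (G y)" for x y
    by (simp add: G_def cadjoint_cinner[OF A] cadjoint_cinner_right[OF A])
  then have Bs: "cinner (B x) y = cinner x (B y)" for x y
    by (simp add: B_def cinner_simps)
  have nB: "norm (B x) \<le> norm x" for x
  proof -
    define r where "r = 1 / M\<^sup>2"
    have r: "complex_of_real r = 1 / of_real (M\<^sup>2)" "r * M\<^sup>2 = 1" "0 < r" using M by (auto simp: r_def)
    have xG: "Re (cinner x (G x)) = (norm (A x))\<^sup>2" "Re (cinner (G x) x) = (norm (A x))\<^sup>2"
      by (simp_all add: G_def cadjoint_cinner[OF A] cadjoint_cinner_right[OF A] norm_sq_cinner)
    have "(norm (B x))\<^sup>2 = (norm x)\<^sup>2 - 2 * r * (norm (A x))\<^sup>2 + r\<^sup>2 * (norm (G x))\<^sup>2"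
      unfolding B_def r(1)[symmetric]
      by (simp add: norm_sq_cinner[of "x - _"] cinner_simps xG)
        (simp add: norm_sq_cinner power2_eq_square[of r] algebra_simps)
    also have "(norm (G x))\<^sup>2 \<le> (M * norm (A x))\<^sup>2"
      unfolding G_def using A M by (intro power_mono norm_cadjoint_le) auto
    also have "r\<^sup>2 * (M * norm (A x))\<^sup>2 = (r * M\<^sup>2) * r * (norm (A x))\<^sup>2"
      by (simp add: power2_eq_square mult_ac)
    finally have "(norm (B x))\<^sup>2 \<le> (norm x)\<^sup>2 - r * (norm (A x))\<^sup>2"
      using r by (simp add: mult_left_mono algebra_simps)
    also have "\<dots> \<le> (norm x)\<^sup>2" using r by simp
    finally show ?thesis by (rule power2_le_imp_le) simp
  qed
  obtain Q where Q: "positive_op Q" "\<And>x. Q (Q x) = x - B x"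
    "\<And>T x. bounded_linear T \<Longrightarrow> (\<And>x. T (B x) = B (T x)) \<Longrightarrow> T (Q x) = Q (T x)"
    using sqrt_id_minus_exists[OF Bc Bs nB] by metis
  define P where "P x = of_real M *\<^sub>C Q x" for x
  have Qc: "bounded_clinear Q" using Q(1) by (rule positive_op_bounded)
  have "positive_op P"
  proof (rule positive_opI)
    show "bounded_clinear P" unfolding P_def by (rule bounded_clinear_scaled[OF Qc])
    show "cinner (P x) y = cinner x (P y)" for x y
      by (simp add: P_def cinner_simps positive_op_sym[OF Q(1)])
    show "0 \<le> Re (cinner x (P x))" for x
      using positive_op_nonneg[OF Q(1), of x] M by (simp add: P_def cinner_simps)
  qed
  moreover have "P (P x) = G x" for x
    using M by (simp add: P_def bounded_clinear_scaleC[OF Qc] scaleC_scaleC Q(2) B_def power2_eq_square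
        scaleC_one)
  moreover have "T (P x) = P (T x)" if T: "bounded_clinear T" and "\<And>x. T (G x) = G (T x)" for T x
    using Q(3)[OF bounded_clinear_bl[OF T], of x] that
    by (simp add: P_def B_def bounded_clinear_diff[OF T] bounded_clinear_scaleC[OF T])
  ultimately show ?thesis using that[of P] unfolding G_def by blast
qed

text \<open>For \<open>y = P x - Q x\<close> commutation gives \<open>P y + Q y = P\<^sup>2 x - Q\<^sup>2 x = 0\<close>, so both quadratic forms vanish
at \<open>y\<close>, whence \<open>P y = Q y = 0\<close> and finally \<open>y = 0\<close>.\<close>

lemma positive_sqrt_unique_commuting:
  assumes P: "positive_op P" and Q: "positive_op Q" and eq: "\<And>x. P (P x) = Q (Q x)"
    and comm: "\<And>x. P (Q x) = Q (P x)"
  shows "P = Q"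
proof
  fix x
  have Pc: "bounded_clinear P" and Qc: "bounded_clinear Q" using P Q by (auto intro: positive_op_bounded)
  define y where "y = P x - Q x"
  have "P y + Q y = 0"
    by (simp add: y_def bounded_clinear_diff[OF Pc] bounded_clinear_diff[OF Qc] eq comm)
  then have "Re (cinner y (P y)) + Re (cinner y (Q y)) = 0"
    by (metis cinner_add_right cinner_zero_right plus_complex.simps(1) zero_complex.simps(1))
  then have z: "Re (cinner y (P y)) = 0" "Re (cinner y (Q y)) = 0"
    using positive_op_nonneg[OF P, of y] positive_op_nonneg[OF Q, of y] by linarith+
  have ker: "R y = 0" if "positive_op R" "Re (cinner y (R y)) = 0" for R
    using positive_op_cauchy_schwarz[OF that(1), of "R y" y] that(2) by (simp add: cinner_self)
  have "cinner y y = cinner x (P y - Q y)"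
    by (simp add: cinner_diff_right positive_op_sym[OF P, symmetric] positive_op_sym[OF Q, symmetric])
      (simp add: y_def cinner_diff_left)
  then have "cinner y y = 0" using ker[OF P z(1)] ker[OF Q z(2)] by simp
  then show "P x = Q x" by (simp add: cinner_self y_def)
qed

text \<open>Any two roots are compared with the constructed root \<open>R\<close>: a root commutes with its own square,
hence with \<open>R\<close>.\<close>

lemma positive_sqrt_unique:
  assumes A: "bounded_clinear A" and P: "positive_op P" "P \<circ> P = cadjoint A \<circ> A"
    and Q: "positive_op Q" "Q \<circ> Q = cadjoint A \<circ> A"
  shows "P = Q"
proof -
  obtain R where R: "positive_op R" "\<And>x. R (R x) = cadjoint A (A x)"
    "\<And>T x. bounded_clinear T \<Longrightarrow> (\<And>x. T (cadjoint A (A x)) = cadjoint A (A (T x))) \<Longrightarrow> T (R x) = R (T x)"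
    using sqrt_cadjoint_comp_exists[OF A] by metis
  have "S = R" if S: "positive_op S" "S \<circ> S = cadjoint A \<circ> A" for S
  proof (rule positive_sqrt_unique_commuting[OF S(1) R(1)])
    have SS: "cadjoint A (A x) = S (S x)" for x using S(2) by (metis comp_apply)
    show "S (S x) = R (R x)" for x by (simp add: R(2) SS)
    show "S (R x) = R (S x)" for x by (rule R(3)[OF positive_op_bounded[OF S(1)]]) (simp add: SS)
  qed
  then show ?thesis using P Q by blast
qed

lemma abs_op_eqI:
  assumes "bounded_clinear A" "positive_op P" "P \<circ> P = cadjoint A \<circ> A"
  shows "abs_op A = P"
  unfolding abs_op_def using assms positive_sqrt_unique by blast

lemma abs_op_square:
  assumes A: "bounded_clinear A"
  shows "positive_op (abs_op A)" "abs_op A (abs_op A x) = cadjoint A (A x)"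
proof -
  obtain P where P: "positive_op P" "\<And>x. P (P x) = cadjoint A (A x)"
    using sqrt_cadjoint_comp_exists[OF A] by metis
  then have "abs_op A = P" by (intro abs_op_eqI[OF A]) auto
  then show "positive_op (abs_op A)" "abs_op A (abs_op A x) = cadjoint A (A x)" using P by auto
qed

lemma cadjoint_positive_op: "positive_op P \<Longrightarrow> cadjoint P = P"
  by (rule cadjoint_eqI) (simp add: positive_op_sym)

section \<open>The trace norm\<close>

lemma abs_op_positive: "positive_op P \<Longrightarrow> abs_op P = P"
  by (rule abs_op_eqI) (simp_all add: positive_op_bounded cadjoint_positive_op)

lemma abs_op_neg_positive:
  assumes P: "positive_op P"
  shows "abs_op (\<lambda>x. - P x) = P"
proof (rule abs_op_eqI[OF bounded_clinear_neg[OF positive_op_bounded[OF P]] P])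
  have "cadjoint (\<lambda>x. - P x) = (\<lambda>x. - P x)"
    by (rule cadjoint_eqI) (simp add: cinner_simps positive_op_sym[OF P])
  then show "P \<circ> P = cadjoint (\<lambda>x. - P x) \<circ> (\<lambda>x. - P x)"
    by (auto simp: bounded_clinear_minus[OF positive_op_bounded[OF P]])
qed

lemma trace_norm_neg_positive: "positive_op P \<Longrightarrow> trace_norm (\<lambda>x. - P x) = trace_norm P"
  by (simp add: trace_norm_def abs_op_positive abs_op_neg_positive)

lemma trace_norm_mono:
  assumes "positive_op P" "positive_op Q" "\<And>x. Re (cinner x (P x)) \<le> Re (cinner x (Q x))"
  shows "trace_norm P \<le> trace_norm Q"
  unfolding trace_norm_def abs_op_positive[OF assms(1)] abs_op_positive[OF assms(2)]
  by (intro infsum_mono nonneg_summable_on_complete ennreal_leI assms(3)) auto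

text \<open>For a finite combination \<open>v\<close> of basis vectors, the Cauchy-Schwarz inequality for the form of \<open>P\<close>
and the one for finite sums bound \<open>(q v)\<^sup>2\<close> by \<open>\<parallel>v\<parallel>\<^sup>2 q v \<tau>\<close>; the general case follows by density.\<close>

lemma quadratic_form_le_trace_norm:
  assumes P: "positive_op P" and tr: "trace_norm P \<le> ennreal \<tau>" and \<tau>: "0 \<le> \<tau>"
  shows "Re (cinner v (P v)) \<le> \<tau> * (norm v)\<^sup>2"
proof -
  let ?E = "some_onb :: 'a set"
  define q where "q v = Re (cinner v (P v))" for v
  have q0: "0 \<le> q v" for v unfolding q_def by (rule positive_op_nonneg[OF P])
  have Pc: "bounded_clinear P" by (rule positive_op_bounded[OF P])
  have sumq: "(\<Sum>e\<in>F. q e) \<le> \<tau>" if "finite F" "F \<subseteq> ?E" for F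
  proof -
    have "ennreal (\<Sum>e\<in>F. q e) = (\<Sum>e\<in>F. ennreal (q e))" by (simp add: q0)
    also have "\<dots> \<le> (\<Sum>\<^sub>\<infinity>e\<in>?E. ennreal (q e))"
      unfolding infsum_finite[OF that(1), symmetric]
      by (rule infsum_mono_neutral) (use that in \<open>auto intro!: nonneg_summable_on_complete\<close>)
    also have "\<dots> \<le> ennreal \<tau>" using tr by (simp add: trace_norm_def abs_op_positive[OF P] q_def)
    finally show ?thesis using \<tau> by simp
  qed
  have onb: "\<And>e f. e \<in> ?E \<Longrightarrow> f \<in> ?E \<Longrightarrow> cinner e f = (if e = f then 1 else 0)"
    and tot: "closure (cspan ?E) = UNIV" using some_onb unfolding is_onb_def by auto
  have span: "q v \<le> \<tau> * (norm v)\<^sup>2" if "v \<in> cspan ?E" for v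
  proof -
    obtain F c where F: "finite F" "F \<subseteq> ?E" and v: "v = (\<Sum>e\<in>F. c e *\<^sub>C e)"
      using \<open>v \<in> cspan ?E\<close> unfolding complex_vector.span_explicit by blast
    have nv: "(norm v)\<^sup>2 = (\<Sum>e\<in>F. (cmod (c e))\<^sup>2)"
    proof -
      have "cinner v v = (\<Sum>f\<in>F. \<Sum>e\<in>F. c f * (cnj (c e) * cinner e f))"
        by (simp add: v cinner_sum_left cinner_sum_right cinner_simps sum_distrib_left)
      also have "\<dots> = (\<Sum>f\<in>F. \<Sum>e\<in>F. if e = f then c f * cnj (c f) else 0)"
        using F(2) by (intro sum.cong refl) (simp add: onb subset_iff)
      also have "\<dots> = (\<Sum>e\<in>F. of_real ((cmod (c e))\<^sup>2))"
        using F(1) by (simp add: complex_norm_square del: of_real_power)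
      finally show ?thesis by (simp add: norm_sq_cinner)
    qed
    have "q v = Re (\<Sum>e\<in>F. c e * cinner v (P e))"
      unfolding q_def
      by (subst (2) v) (simp add: bounded_clinear_sum[OF Pc] bounded_clinear_scaleC[OF Pc]
          cinner_sum_right cinner_scaleC_right)
    also have "\<dots> \<le> cmod (\<Sum>e\<in>F. c e * cinner v (P e))" by (rule complex_Re_le_cmod)
    also have "\<dots> \<le> (\<Sum>e\<in>F. cmod (c e) * cmod (cinner v (P e)))"
      by (rule order_trans[OF norm_sum]) (simp add: norm_mult)
    finally have "(q v)\<^sup>2 \<le> (\<Sum>e\<in>F. cmod (c e) * cmod (cinner v (P e)))\<^sup>2"
      using q0 by (intro power_mono) auto
    also have "\<dots> \<le> (\<Sum>e\<in>F. (cmod (c e))\<^sup>2) * (\<Sum>e\<in>F. (cmod (cinner v (P e)))\<^sup>2)"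
      by (rule Cauchy_Schwarz_ineq_sum)
    also have "\<dots> \<le> (norm v)\<^sup>2 * (\<Sum>e\<in>F. q v * q e)"
      unfolding nv[symmetric] q_def
      by (intro mult_left_mono sum_mono positive_op_cauchy_schwarz[OF P]) simp
    also have "\<dots> \<le> (norm v)\<^sup>2 * (q v * \<tau>)"
      unfolding sum_distrib_left[symmetric] using sumq[OF F] q0 by (intro mult_left_mono) auto
    finally have "q v * q v \<le> q v * (\<tau> * (norm v)\<^sup>2)" by (simp add: power2_eq_square mult_ac)
    then show ?thesis using q0[of v] \<tau> by (cases "q v = 0") (auto simp: mult_le_cancel_left)
  qed
  have "closed {v. q v \<le> \<tau> * (norm v)\<^sup>2}"
    unfolding q_def
    by (intro closed_Collect_le continuous_intros bounded_bilinear.continuous_on[OF bounded_bilinear_cinner]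
        linear_continuous_on bounded_clinear_bl[OF Pc])
  then have "closure (cspan ?E) \<subseteq> {v. q v \<le> \<tau> * (norm v)\<^sup>2}" using span by (intro closure_minimal) auto
  then show ?thesis using tot unfolding q_def by blast
qed

text \<open>The bridge from the trace norm to pointwise statements. The operators \<open>A\<close> and \<open>P = |A|\<close> have the
same norms on vectors, and the form inequality at \<open>P v\<close> and \<open>v\<close> bounds \<open>\<parallel>P v\<parallel>\<close>.\<close>

lemma norm_le_trace_norm:
  assumes A: "bounded_clinear A" and tr: "trace_norm A \<le> ennreal \<tau>" and \<tau>: "0 \<le> \<tau>"
  shows "norm (A v) \<le> \<tau> * norm v"
proof -
  define P where "P = abs_op A"
  have P: "positive_op P" and PP: "\<And>x. P (P x) = cadjoint A (A x)"
    using abs_op_square[OF A] by (auto simp: P_def)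
  have trP: "trace_norm P \<le> ennreal \<tau>"
    using tr by (simp add: trace_norm_def P_def abs_op_positive[OF abs_op_square(1)[OF A]])
  note q = quadratic_form_le_trace_norm[OF P trP \<tau>]
  have AP: "norm (A v) = norm (P v)"
  proof -
    have "cinner (A v) (A v) = cinner (P v) (P v)"
      by (simp add: positive_op_sym[OF P] PP cadjoint_cinner_right[OF A])
    then have "(norm (A v))\<^sup>2 = (norm (P v))\<^sup>2" by (simp add: norm_sq_cinner)
    then show ?thesis by simp
  qed
  have "((norm (P v))\<^sup>2)\<^sup>2 \<le> Re (cinner (P v) (P (P v))) * Re (cinner v (P v))"
    using positive_op_cauchy_schwarz[OF P, of "P v" v] by (simp add: cinner_self norm_power)
  also have "\<dots> \<le> (\<tau> * (norm (P v))\<^sup>2) * (\<tau> * (norm v)\<^sup>2)"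
    by (intro mult_mono q positive_op_nonneg[OF P]) (simp add: \<tau>)
  finally have *: "(norm (P v))\<^sup>2 * (norm (P v))\<^sup>2 \<le> (norm (P v))\<^sup>2 * (\<tau> * norm v)\<^sup>2"
    by (simp add: power2_eq_square mult_ac)
  have "norm (P v) \<le> \<tau> * norm v"
  proof (cases "P v = 0")
    case False
    then have "(norm (P v))\<^sup>2 \<le> (\<tau> * norm v)\<^sup>2" using * by (intro mult_left_le_imp_le[OF *]) simp
    then show ?thesis by (rule power2_le_imp_le) (simp add: \<tau>)
  qed (simp add: \<tau>)
  then show ?thesis by (simp add: AP)
qed

lemma trace_has_sum_pointwise:
  assumes "trace_has_sum A I S"
  shows "((\<lambda>i. A i x) has_sum S x) I"
  unfolding has_sum_def
proof -
  let ?D = "\<lambda>F u. (\<Sum>i\<in>F. A i u) - S u"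
  have lim: "((\<lambda>F. trace_norm (?D F)) \<longlongrightarrow> 0) (finite_subsets_at_top I)"
    and cl: "\<And>i. i \<in> I \<Longrightarrow> bounded_clinear (A i)" "bounded_clinear S"
    using assms unfolding trace_has_sum_def trace_class_def by auto
  show "(sum (\<lambda>i. A i x) \<longlongrightarrow> S x) (finite_subsets_at_top I)"
  proof (rule tendstoI)
    fix e :: real assume e: "0 < e"
    define \<tau> where "\<tau> = e / (norm x + 1)"
    have \<tau>: "0 < \<tau>" using e by (simp add: \<tau>_def add_nonneg_pos)
    have "\<forall>\<^sub>F F in finite_subsets_at_top I. trace_norm (?D F) < ennreal \<tau>"
      using lim \<tau> by (intro order_tendstoD) auto
    then show "\<forall>\<^sub>F F in finite_subsets_at_top I. dist (\<Sum>i\<in>F. A i x) (S x) < e"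
      using eventually_finite_subsets_at_top_weakI[of I "\<lambda>F. F \<subseteq> I", simplified]
    proof eventually_elim
      case (elim F)
      have "bounded_clinear (?D F)"
        using elim(2) cl by (intro bounded_clinear_minus_op bounded_clinear_sum_op) auto
      then have "norm (?D F x) \<le> \<tau> * norm x"
        using elim(1) \<tau> by (intro norm_le_trace_norm) auto
      also have "\<dots> < \<tau> * (norm x + 1)" using \<tau> by simp
      also have "\<dots> = e" by (simp add: \<tau>_def add_nonneg_eq_0_iff)
      finally show ?case by (simp add: dist_norm)
    qed
  qed
qed

text \<open>Sums in trace norm are unique because they are determined pointwise.\<close>

lemma trace_infsum_eqI:
  assumes S: "trace_has_sum A I S"
  shows "trace_infsum A I = S"
proof -
  have "S' = S" if "trace_has_sum A I S'" for S'
    using has_sum_unique[OF trace_has_sum_pointwise[OF that] trace_has_sum_pointwise[OF S]] by blast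
  then have "(THE S. trace_has_sum A I S) = S" using S by (intro the_equality)
  then show ?thesis unfolding trace_infsum_def using S by auto
qed

section \<open>Operators given on a total family\<close>

text \<open>The norm bound makes the relation between corresponding finite combinations of the \<open>g i\<close> and the
\<open>h i\<close> single valued and Lipschitz. Its closure is the graph of the extension, defined everywhere
because the \<open>g i\<close> are total.\<close>

lemma extend_from_total_family:
  fixes g :: "'i \<Rightarrow> 'a::chilbert_space" and h :: "'i \<Rightarrow> 'b::chilbert_space"
  assumes total: "closure (cspan (range g)) = UNIV" and M: "0 \<le> M"
    and bound: "\<And>F c. finite F \<Longrightarrow> norm (\<Sum>i\<in>F. c i *\<^sub>C h i) \<le> M * norm (\<Sum>i\<in>F. c i *\<^sub>C g i)"
  obtains S where "bounded_clinear S" "\<And>i. S (g i) = h i"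
proof -
  define R where "R = {(x, y). \<exists>F c. finite F \<and> x = (\<Sum>i\<in>F. c i *\<^sub>C g i) \<and> y = (\<Sum>i\<in>F. c i *\<^sub>C h i)}"
  have R_I: "((\<Sum>i\<in>F. c i *\<^sub>C g i), (\<Sum>i\<in>F. c i *\<^sub>C h i)) \<in> R" if "finite F" for F c
    unfolding R_def mem_Collect_eq prod.case using that
    by (intro exI[of _ F] exI[of _ c] conjI refl)
  have R_E: "\<exists>F c. finite F \<and> x = (\<Sum>i\<in>F. c i *\<^sub>C g i) \<and> y = (\<Sum>i\<in>F. c i *\<^sub>C h i)"
    if "(x, y) \<in> R" for x y
    using that unfolding R_def mem_Collect_eq prod.case .
  have R_bound: "norm y \<le> M * norm x" if "(x, y) \<in> R" for x y
    using R_E[OF that] bound by metis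
  have R_gen: "(g i, h i) \<in> R" for i
    using R_I[of "{i}" "\<lambda>_. 1"] by (simp add: scaleC_one)
  have R_add: "(x + x', y + y') \<in> R" if xy: "(x, y) \<in> R" "(x', y') \<in> R" for x y x' y'
  proof -
    obtain F c F' c' where F: "finite F" "finite F'"
      and e: "x = (\<Sum>i\<in>F. c i *\<^sub>C g i)" "y = (\<Sum>i\<in>F. c i *\<^sub>C h i)"
        "x' = (\<Sum>i\<in>F'. c' i *\<^sub>C g i)" "y' = (\<Sum>i\<in>F'. c' i *\<^sub>C h i)"
      using R_E[OF xy(1)] R_E[OF xy(2)] by metis
    define d where "d i = (if i \<in> F then c i else 0) + (if i \<in> F' then c' i else 0)" for i
    have "(\<Sum>i\<in>F. c i *\<^sub>C f i) + (\<Sum>i\<in>F'. c' i *\<^sub>C f i) = (\<Sum>i\<in>F \<union> F'. d i *\<^sub>C f i)"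
      for f :: "'i \<Rightarrow> 'c::chilbert_space"
    proof -
      have "(\<Sum>i\<in>F. c i *\<^sub>C f i) = (\<Sum>i\<in>F \<union> F'. (if i \<in> F then c i else 0) *\<^sub>C f i)"
        by (rule sum.mono_neutral_cong_left) (use F in auto)
      moreover have "(\<Sum>i\<in>F'. c' i *\<^sub>C f i) = (\<Sum>i\<in>F \<union> F'. (if i \<in> F' then c' i else 0) *\<^sub>C f i)"
        by (rule sum.mono_neutral_cong_left) (use F in auto)
      ultimately show ?thesis by (simp add: d_def scaleC_add_left sum.distrib)
    qed
    note this[of g] this[of h]
    then show ?thesis using R_I[of "F \<union> F'" d] F by (simp add: e)
  qed
  have R_scale: "(c *\<^sub>C x, c *\<^sub>C y) \<in> R" if xy: "(x, y) \<in> R" for c x y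
  proof -
    obtain F d where F: "finite F" and e: "x = (\<Sum>i\<in>F. d i *\<^sub>C g i)" "y = (\<Sum>i\<in>F. d i *\<^sub>C h i)"
      using R_E[OF xy] by metis
    have "c *\<^sub>C x = (\<Sum>i\<in>F. (c * d i) *\<^sub>C g i)" "c *\<^sub>C y = (\<Sum>i\<in>F. (c * d i) *\<^sub>C h i)"
      unfolding e by (simp_all add: complex_vector.scale_sum_right scaleC_scaleC)
    then show ?thesis using R_I[OF F, of "\<lambda>i. c * d i"] by simp
  qed
  have R_zero: "(0, 0) \<in> R" using R_I[of "{}"] by simp
  have R_diff: "(x - x', y - y') \<in> R" if xy: "(x, y) \<in> R" "(x', y') \<in> R" for x y x' y'
  proof -
    have "(-1) *\<^sub>C z = - z" for z :: "'c::chilbert_space" using scaleC_of_real[of "-1" z] by simp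
    then show ?thesis using R_add[OF xy(1) R_scale[OF xy(2), of "-1"]] by simp
  qed
  have dom: "\<exists>y. (x, y) \<in> R" if "x \<in> cspan (range g)" for x
  proof -
    have "complex_vector.subspace {x. \<exists>y. (x, y) \<in> R}"
      unfolding complex_vector.subspace_def using R_zero R_add R_scale by blast
    then have "cspan (range g) \<subseteq> {x. \<exists>y. (x, y) \<in> R}"
      using R_gen by (intro complex_vector.span_minimal) auto
    then show ?thesis using that by blast
  qed
  define G where "G x y \<longleftrightarrow> (\<exists>u v. (\<forall>n. (u n, v n) \<in> R) \<and> u \<longlonglongrightarrow> x \<and> v \<longlonglongrightarrow> y)" for x y
  have G_R: "G x y" if "(x, y) \<in> R" for x y
    unfolding G_def using that by (intro exI[of _ "\<lambda>_. x"] exI[of _ "\<lambda>_. y"]) auto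
  have G_bound: "norm y \<le> M * norm x" if xy: "G x y" for x y
  proof -
    obtain u v where "\<And>n. (u n, v n) \<in> R" and lim: "u \<longlonglongrightarrow> x" "v \<longlonglongrightarrow> y"
      using xy unfolding G_def by blast
    then have "\<And>n. norm (v n) \<le> M * norm (u n)" using R_bound by blast
    then show ?thesis
      by (intro LIMSEQ_le[OF tendsto_norm[OF lim(2)] tendsto_mult_left[OF tendsto_norm[OF lim(1)]]]) auto
  qed
  have G_add: "G (x + x') (y + y')" if xy: "G x y" "G x' y'" for x y x' y'
  proof -
    obtain u v u' v' where "\<And>n. (u n, v n) \<in> R" "u \<longlonglongrightarrow> x" "v \<longlonglongrightarrow> y"
      "\<And>n. (u' n, v' n) \<in> R" "u' \<longlonglongrightarrow> x'" "v' \<longlonglongrightarrow> y'"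
      using xy unfolding G_def by blast
    then show ?thesis unfolding G_def
      by (intro exI[of _ "\<lambda>n. u n + u' n"] exI[of _ "\<lambda>n. v n + v' n"] conjI allI R_add tendsto_add)
  qed
  have G_scale: "G (c *\<^sub>C x) (c *\<^sub>C y)" if xy: "G x y" for c x y
  proof -
    obtain u v where "\<And>n. (u n, v n) \<in> R" "u \<longlonglongrightarrow> x" "v \<longlonglongrightarrow> y"
      using xy unfolding G_def by blast
    then show ?thesis unfolding G_def
      by (intro exI[of _ "\<lambda>n. c *\<^sub>C u n"] exI[of _ "\<lambda>n. c *\<^sub>C v n"] conjI allI R_scale
          tendsto_scaleC tendsto_const)
  qed
  have G_fun: "y = y'" if "G x y" "G x y'" for x y y'
  proof -
    have "(-1) *\<^sub>C z = - z" for z :: "'c::chilbert_space" using scaleC_of_real[of "-1" z] by simp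
    then have "G 0 (y - y')" using G_add[OF that(1) G_scale[OF that(2), of "-1"]] by simp
    then show ?thesis using G_bound[of 0 "y - y'"] by simp
  qed
  have G_total: "\<exists>y. G x y" for x
  proof -
    have "x \<in> closure (cspan (range g))" using total by simp
    then obtain u where u: "\<And>n. u n \<in> cspan (range g)" "u \<longlonglongrightarrow> x"
      unfolding closure_sequential by blast
    obtain v where v: "\<And>n. (u n, v n) \<in> R" using dom[OF u(1)] by metis
    have "Cauchy v"
    proof (rule metric_CauchyI)
      fix e :: real assume e: "0 < e"
      have "Cauchy u" using u(2) by (rule LIMSEQ_imp_Cauchy)
      moreover have "0 < e / (M + 1)" using e M by simp
      ultimately obtain N where N: "\<And>m n. m \<ge> N \<Longrightarrow> n \<ge> N \<Longrightarrow> dist (u m) (u n) < e / (M + 1)"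
        unfolding Cauchy_def by metis
      have "dist (v m) (v n) < e" if "m \<ge> N" "n \<ge> N" for m n
      proof -
        have "dist (v m) (v n) \<le> M * dist (u m) (u n)"
          using R_bound[OF R_diff[OF v v]] by (simp add: dist_norm)
        also have "\<dots> \<le> M * (e / (M + 1))" using N[OF that] M by (intro mult_left_mono) auto
        also have "\<dots> < e" using e M by (simp add: field_simps)
        finally show ?thesis .
      qed
      then show "\<exists>N. \<forall>m\<ge>N. \<forall>n\<ge>N. dist (v m) (v n) < e" by blast
    qed
    then obtain y where "v \<longlonglongrightarrow> y" using Cauchy_convergent convergent_def by blast
    then show ?thesis unfolding G_def using u v by blast
  qed
  obtain S where S: "\<And>x. G x (S x)" using G_total by metis
  have "bounded_clinear S"
  proof (rule bounded_clinearI)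
    show "S (x + y) = S x + S y" for x y by (rule G_fun[OF S G_add[OF S S]])
    show "S (c *\<^sub>C x) = c *\<^sub>C S x" for c x by (rule G_fun[OF S G_scale[OF S]])
    show "norm (S x) \<le> norm x * M" for x using G_bound[OF S] by (simp add: mult.commute)
  qed
  moreover have "S (g i) = h i" for i by (rule G_fun[OF S G_R[OF R_gen]])
  ultimately show ?thesis using that by blast
qed

lemma cinner_ext_total:
  assumes E: "closure (cspan E) = UNIV" and eq: "\<And>e. e \<in> E \<Longrightarrow> cinner e x = cinner e y"
  shows "x = y"
proof -
  have "{z. cinner z x = cinner z y} = UNIV"
  proof (rule closed_subspace_total[OF E])
    show "complex_vector.subspace {z. cinner z x = cinner z y}"
      by (auto simp: complex_vector.subspace_def cinner_simps)
    show "closed {z. cinner z x = cinner z y}"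
      by (intro closed_Collect_eq bounded_bilinear.continuous_on[OF bounded_bilinear_cinner]
          continuous_on_id continuous_on_const)
  qed (use eq in auto)
  then show ?thesis using cinner_ext[of x y] by blast
qed

lemma symmetric_on_total:
  assumes E: "closure (cspan E) = UNIV" and S: "bounded_clinear S"
    and eq: "\<And>x y. x \<in> E \<Longrightarrow> y \<in> E \<Longrightarrow> cinner (S x) y = cinner x (S y)"
  shows "cinner (S x) y = cinner x (S y)"
proof -
  have "cadjoint S y = S y" if "y \<in> E" for y
    by (rule cinner_ext_total[OF E]) (simp add: cadjoint_cinner_right[OF S] eq that)
  then have "cadjoint S = S"
    by (rule bounded_clinear_eq_on_total[OF E bounded_clinear_cadjoint[OF S] S])
  then show ?thesis using cadjoint_cinner[OF S, of x y] by simp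
qed

section \<open>Tensor powers of operators\<close>

lemma cinner_tensor_power: "is_tensor_power t \<Longrightarrow> cinner (t u) (t v) = (\<Prod>j\<in>UNIV. cinner (u j) (v j))"
  and tensor_power_total: "is_tensor_power t \<Longrightarrow> closure (cspan (range t)) = UNIV"
  by (simp_all add: is_tensor_power_def)

text \<open>To let \<open>B\<close> act on the slot \<open>j\<close> alone, finite combinations of elementary tensors must be mapped
boundedly. With \<open>T\<close> the defect operator of \<open>B\<close>, the combination with \<open>B\<close> and the one with \<open>T\<close> in
slot \<open>j\<close> have squared norms that add up, with the weight \<open>M\<^sup>2\<close> on the second, to \<open>M\<^sup>2\<close> times the
squared norm of the given one; dropping the second leaves the bound.\<close>

lemma tensor_power_slot_operator:
  fixes t :: "('d::finite \<Rightarrow> 'a::chilbert_space) \<Rightarrow> 'c::chilbert_space"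
  assumes t: "is_tensor_power t" and B: "bounded_clinear B"
  obtains S where "bounded_clinear S" "\<And>u. S (t u) = t (u(j := B (u j)))"
proof -
  obtain M where M: "M > 0" "\<And>x. norm (B x) \<le> M * norm x"
    using bounded_clinear_bound[OF B] by metis
  obtain T where "positive_op T" and T: "\<And>x y. cinner (B x) (B y) + (of_real (M\<^sup>2)) * cinner (T x) (T y) = of_real (M\<^sup>2) * cinner x y"
    by (rule contraction_defect_exists[OF B M]) (rule that)
  define h where "h X u = t (u(j := X (u j)))" for X :: "'a \<Rightarrow> 'a" and u
  have hh: "cinner (h X u) (h X v) = cinner (X (u j)) (X (v j)) * (\<Prod>l\<in>UNIV - {j}. cinner (u l) (v l))" for X u v
  proof -
    have "cinner (h X u) (h X v) = (\<Prod>l\<in>UNIV. cinner ((u(j := X (u j))) l) ((v(j := X (v j))) l))"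
      unfolding h_def by (rule cinner_tensor_power[OF t])
    then show ?thesis by (simp add: prod.remove[of UNIV j])
  qed
  have key: "cinner (h B u) (h B v) + of_real (M\<^sup>2) * cinner (h T u) (h T v) = of_real (M\<^sup>2) * cinner (t u) (t v)" for u v
  proof -
    define r where "r = (\<Prod>l\<in>UNIV - {j}. cinner (u l) (v l))"
    have "h (\<lambda>x. x) u = t u" for u by (simp add: h_def)
    then have tt: "cinner (t u) (t v) = cinner (u j) (v j) * r"
      using hh[of "\<lambda>x. x" u v] by (simp add: r_def)
    show ?thesis
      unfolding tt hh r_def[symmetric] using arg_cong[OF T[of "u j" "v j"], of "\<lambda>z. z * r"]
      by (simp only: distrib_right mult.assoc)
  qed
  have quad: "cinner (\<Sum>u\<in>F. c u *\<^sub>C f u) (\<Sum>u\<in>F. c u *\<^sub>C f u) = (\<Sum>v\<in>F. \<Sum>u\<in>F. c v * (cnj (c u) * cinner (f u) (f v)))"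
    for F c and f :: "('d \<Rightarrow> 'a) \<Rightarrow> 'c"
    by (simp add: cinner_sum_left cinner_sum_right cinner_simps sum_distrib_left)
  have "norm (\<Sum>u\<in>F. c u *\<^sub>C h B u) \<le> M * norm (\<Sum>u\<in>F. c u *\<^sub>C t u)" for F c
  proof -
    let ?n = "\<lambda>f. \<Sum>u\<in>F. c u *\<^sub>C f u"
    have "cinner (?n (h B)) (?n (h B)) + of_real (M\<^sup>2) * cinner (?n (h T)) (?n (h T))
        = of_real (M\<^sup>2) * cinner (?n t) (?n t)"
      unfolding quad sum_distrib_left sum.distrib[symmetric] mult.assoc[symmetric]
    proof (intro sum.cong refl)
      fix v u
      show "c v * cnj (c u) * cinner (h B u) (h B v) + of_real (M\<^sup>2) * c v * cnj (c u) * cinner (h T u) (h T v)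
         = of_real (M\<^sup>2) * c v * cnj (c u) * cinner (t u) (t v)"
        using arg_cong[OF key[of u v], of "\<lambda>z. c v * cnj (c u) * z"] by (simp add: algebra_simps del: of_real_power)
    qed
    then have "complex_of_real ((norm (?n (h B)))\<^sup>2 + M\<^sup>2 * (norm (?n (h T)))\<^sup>2) = of_real (M\<^sup>2 * (norm (?n t))\<^sup>2)"
      by (simp only: cinner_self of_real_add of_real_mult)
    then have "(norm (?n (h B)))\<^sup>2 + M\<^sup>2 * (norm (?n (h T)))\<^sup>2 = M\<^sup>2 * (norm (?n t))\<^sup>2"
      by (simp only: of_real_eq_iff)
    moreover have "0 \<le> M\<^sup>2 * (norm (?n (h T)))\<^sup>2" by simp
    ultimately have "(norm (?n (h B)))\<^sup>2 \<le> M\<^sup>2 * (norm (?n t))\<^sup>2" by linarith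
    then have "(norm (?n (h B)))\<^sup>2 \<le> (M * norm (?n t))\<^sup>2" by (simp only: power_mult_distrib)
    then show ?thesis by (rule power2_le_imp_le) (use M in simp)
  qed
  moreover have "closure (cspan (range t)) = UNIV" by (rule tensor_power_total[OF t])
  ultimately show ?thesis
    using extend_from_total_family[of t M "h B"] M(1) that unfolding h_def by (metis less_imp_le)
qed

text \<open>The slots are treated one after the other.\<close>

lemma tensor_power_op_exists:
  assumes t: "is_tensor_power t" and A: "\<And>j. bounded_clinear (A j)"
  shows "\<exists>S. bounded_clinear S \<and> (\<forall>u. S (t u) = t (\<lambda>j. A j (u j)))"
proof -
  have "\<exists>S. bounded_clinear S \<and> (\<forall>u. S (t u) = t (\<lambda>j. if j \<in> J then A j (u j) else u j))"
    if "finite J" for J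
    using that
  proof (induction J)
    case empty
    then show ?case using bounded_clinear_id by auto
  next
    case (insert i J)
    then obtain S where S: "bounded_clinear S" "\<And>u. S (t u) = t (\<lambda>j. if j \<in> J then A j (u j) else u j)"
      by blast
    obtain S' where S': "bounded_clinear S'" "\<And>u. S' (t u) = t (u(i := A i (u i)))"
      using tensor_power_slot_operator[OF t A] by metis
    have "(\<lambda>j. if j \<in> J then A j (u j) else u j)(i := A i (u i)) = (\<lambda>j. if j \<in> insert i J then A j (u j) else u j)" for u
      using insert(2) by auto
    then have "S' (S (t u)) = t (\<lambda>j. if j \<in> insert i J then A j (u j) else u j)" for u
      using insert(2) by (simp add: S S')
    then show ?case using bounded_clinear_comp[OF S'(1) S(1)] by blast
  qed
  from this[of UNIV] show ?thesis by simp
qed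

text \<open>Justifies the definite description in \<open>tensor_power_op\<close>.\<close>

lemma tensor_power_op:
  assumes t: "is_tensor_power t" and A: "\<And>j. bounded_clinear (A j)"
  shows "bounded_clinear (tensor_power_op t A)" "tensor_power_op t A (t u) = t (\<lambda>j. A j (u j))"
proof -
  have tot: "closure (cspan (range t)) = UNIV" by (rule tensor_power_total[OF t])
  have "\<exists>!S. bounded_clinear S \<and> (\<forall>u. S (t u) = t (\<lambda>j. A j (u j)))"
  proof (rule ex_ex1I[OF tensor_power_op_exists[OF assms]])
    fix S S' assume S: "bounded_clinear S \<and> (\<forall>u. S (t u) = t (\<lambda>j. A j (u j)))"
      and S': "bounded_clinear S' \<and> (\<forall>u. S' (t u) = t (\<lambda>j. A j (u j)))"
    then show "S = S'" by (intro bounded_clinear_eq_on_total[OF tot]) auto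
  qed
  from theI'[OF this]
  show "bounded_clinear (tensor_power_op t A)" "tensor_power_op t A (t u) = t (\<lambda>j. A j (u j))"
    unfolding tensor_power_op_def by blast+
qed

lemma tensor_power_op_symmetric:
  assumes t: "is_tensor_power t" and A: "\<And>j. bounded_clinear (A j)"
    and sym: "\<And>j x y. cinner (A j x) y = cinner x (A j y)"
  shows "cinner (tensor_power_op t A x) y = cinner x (tensor_power_op t A y)"
proof (rule symmetric_on_total[where E = "range t"])
  show "closure (cspan (range t)) = UNIV" by (rule tensor_power_total[OF t])
  show "bounded_clinear (tensor_power_op t A)" by (rule tensor_power_op[OF t A])
  have "cinner (t u) (t v) = (\<Prod>j\<in>UNIV. cinner (u j) (v j))" for u v
    by (rule cinner_tensor_power[OF t])
  then show "cinner (tensor_power_op t A x) y = cinner x (tensor_power_op t A y)"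
    if "x \<in> range t" "y \<in> range t" for x y
    using that by (auto simp: tensor_power_op(2)[OF t A] sym)
qed

section \<open>The operators of the walk\<close>

lemma B_op_bounded_symmetric:
  assumes D: "bounded_clinear (D n)"
  shows "bounded_clinear (B_op D n s)" "cinner (B_op D n s x) y = cinner x (B_op D n s y)"
proof -
  note bc = bounded_clinear_plus[OF bounded_clinear_cadjoint[OF D] D]
  have "bounded_clinear (\<lambda>u. (1/2) *\<^sub>C (cadjoint (D n) u + D n u - u))"
    "bounded_clinear (\<lambda>u. (1/2) *\<^sub>C (cadjoint (D n) u + D n u + u))"
    by (intro bounded_clinear_scaled bounded_clinear_minus_op bounded_clinear_plus[OF bc] bc bounded_clinear_id)+
  then show "bounded_clinear (B_op D n s)"
    unfolding B_op_def L_op_def[abs_def] R_op_def[abs_def] by simp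
  show "cinner (B_op D n s x) y = cinner x (B_op D n s y)"
    unfolding B_op_def L_op_def[abs_def] R_op_def[abs_def]
    by (simp add: cinner_scaleC_left cinner_scaleC_right)
      (simp add: cinner_simps cadjoint_cinner[OF D] cadjoint_cinner_right[OF D])
qed

lemma unitary_iso_inv:
  assumes K: "unitary_iso K"
  shows "bounded_clinear (inv K)" "cinner (K x) y = cinner x (inv K y)"
proof -
  have Kc: "bounded_clinear K" and s: "surj K" and i: "\<And>x y. cinner (K x) (K y) = cinner x y"
    using K by (auto simp: unitary_iso_def)
  have KK: "K (inv K y) = y" for y using s by (rule surj_f_inv_f)
  show adj: "cinner (K x) y = cinner x (inv K y)" for x y
    using i[of x "inv K y"] by (simp add: KK)
  then have "cadjoint K = inv K"
    by (intro cadjoint_eqI) (metis cinner_commute)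
  then show "bounded_clinear (inv K)" using bounded_clinear_cadjoint[OF Kc] by simp
qed

lemma C_op_bounded_symmetric:
  assumes D: "bounded_clinear (D n)" and tp: "is_tensor_power tp" and K: "unitary_iso K"
  shows "bounded_clinear (C_op D tp K n \<epsilon>)" "cinner (C_op D tp K n \<epsilon> x) y = cinner x (C_op D tp K n \<epsilon> y)"
proof -
  let ?T = "tensor_power_op tp (\<lambda>j. B_op D n (\<epsilon> $ j))"
  have Tc: "bounded_clinear ?T" by (intro tensor_power_op tp B_op_bounded_symmetric D)
  have Ts: "cinner (?T x) y = cinner x (?T y)" for x y
    by (intro tensor_power_op_symmetric tp B_op_bounded_symmetric D)
  have Kc: "bounded_clinear K" using K by (simp add: unitary_iso_def)
  have "bounded_clinear (\<lambda>x. K (?T (inv K x)))"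
    by (intro bounded_clinear_comp[OF Kc] bounded_clinear_comp[OF Tc] unitary_iso_inv K)
  then show "bounded_clinear (C_op D tp K n \<epsilon>)" by (simp add: C_op_def o_def)
  show "cinner (C_op D tp K n \<epsilon> x) y = cinner x (C_op D tp K n \<epsilon> y)"
    using unitary_iso_inv(2)[OF K] by (simp add: C_op_def Ts) (metis Ts cinner_commute)
qed

lemma cinner_delta:
  fixes cl :: "('i \<Rightarrow> complex) \<Rightarrow> 'l::chilbert_space"
  assumes cl: "is_l2 cl"
  shows "cinner (delta cl x) (delta cl y) = (if x = y then 1 else 0)"
proof -
  let ?d = "\<lambda>x y. if y = x then 1 else (0::complex)"
  have "(\<lambda>y. (cmod (?d x y))\<^sup>2) = indicator {x}" for x :: 'i by (auto simp: indicator_def)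
  then have sq: "square_integrable (count_space UNIV) (?d x)" for x :: 'i
    unfolding square_integrable_def by (simp add: integrable_indicator_iff)
  have "cinner (delta cl x) (delta cl y) = (\<integral>s. cnj (?d x s) * ?d y s \<partial>count_space UNIV)"
  proof -
    have "cinner (cl f) (cl g) = (\<integral>s. cnj (f s) * g s \<partial>count_space UNIV)"
      if "square_integrable (count_space UNIV) f" "square_integrable (count_space UNIV) g" for f g
      using cl that unfolding is_L2_def by blast
    from this[OF sq sq] show ?thesis unfolding delta_def .
  qed
  also have "\<dots> = (\<Sum>s\<in>{s \<in> UNIV. cnj (?d x s) * ?d y s \<noteq> 0}. cnj (?d x s) * ?d y s)"
    by (rule lebesgue_integral_count_space_finite_support) (rule finite_subset[of _ "{x}"], auto)
  also have "{s \<in> UNIV. cnj (?d x s) * ?d y s \<noteq> 0} = (if x = y then {x} else {})" by auto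
  finally show ?thesis by auto
qed

lemma tensor_left_bounded: "is_tensor t \<Longrightarrow> bounded_clinear (t e)"
  by (simp add: is_tensor_def)

lemma cadjoint_tensor_left:
  assumes t: "is_tensor t"
  shows "cadjoint (t e) (t u v) = cinner e u *\<^sub>C v"
proof (rule cinner_ext)
  fix z
  have "cinner (t e z) (t u v) = cinner e u * cinner z v"
    using t by (simp add: is_tensor_def)
  then show "cinner z (cadjoint (t e) (t u v)) = cinner z (cinner e u *\<^sub>C v)"
    by (simp add: cadjoint_cinner_right[OF tensor_left_bounded[OF t]] cinner_scaleC_right)
qed

text \<open>With \<open>t e\<close> in the role of the isometry onto a block, this factorization reduces the double tensor
products of the walk to operators on the second tensor factor.\<close>

lemma tensor_op_ketbra:
  assumes t: "is_tensor t" and C: "bounded_clinear C"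
  shows "tensor_op t (ketbra e f) C = (\<lambda>w. t e (C (cadjoint (t f) w)))"
  unfolding tensor_op_def
proof (rule the_equality)
  let ?S = "\<lambda>w. t e (C (cadjoint (t f) w))"
  note tb = tensor_left_bounded[OF t]
  have Sc: "bounded_clinear ?S"
    by (intro bounded_clinear_comp[OF tb] bounded_clinear_comp[OF C] bounded_clinear_cadjoint tb)
  have tl: "bounded_clinear (\<lambda>u. t u v)" for v using t by (simp add: is_tensor_def)
  have S: "?S (t u v) = t (ketbra e f u) (C v)" for u v
    by (simp add: cadjoint_tensor_left[OF t] ketbra_def bounded_clinear_scaleC[OF C]
        bounded_clinear_scaleC[OF tb] bounded_clinear_scaleC[OF tl])
  show "bounded_clinear ?S \<and> (\<forall>u v. ?S (t u v) = t (ketbra e f u) (C v))" using Sc S by blast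
  fix S' assume S': "bounded_clinear S' \<and> (\<forall>u v. S' (t u v) = t (ketbra e f u) (C v))"
  show "S' = ?S"
  proof (rule bounded_clinear_eq_on_total)
    show "closure (cspan {t u v | u v. True}) = UNIV" using t by (simp add: is_tensor_def)
    show "S' x = ?S x" if "x \<in> {t u v | u v. True}" for x using that S' S by auto
  qed (use S' Sc in auto)
qed

lemma finite_Lambda_d: "finite (Lambda_d :: (int ^ 'd::finite) set)"
proof -
  have "finite (PiE (UNIV :: 'd set) (\<lambda>_. {-1, 1 :: int}))" by (intro finite_PiE) auto
  moreover have "Lambda_d \<subseteq> vec_lambda ` (PiE (UNIV :: 'd set) (\<lambda>_. {-1, 1 :: int}))"
  proof
    fix \<epsilon> :: "int ^ 'd" assume "\<epsilon> \<in> Lambda_d"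
    then have "vec_nth \<epsilon> \<in> PiE UNIV (\<lambda>_. {-1, 1})" by (auto simp: Lambda_d_def)
    then show "\<epsilon> \<in> vec_lambda ` (PiE UNIV (\<lambda>_. {-1, 1}))" by (rule rev_image_eqI) simp
  qed
  ultimately show ?thesis by (rule rev_finite_subset[OF finite_imageI])
qed

section \<open>Sums of positive operators\<close>

lemma positive_op_conj:
  assumes P: "positive_op P" and X: "bounded_clinear X"
  shows "positive_op (\<lambda>w. X (P (cadjoint X w)))"
proof (rule positive_opI)
  show "bounded_clinear (\<lambda>w. X (P (cadjoint X w)))"
    by (intro bounded_clinear_comp[OF X] bounded_clinear_comp[OF positive_op_bounded[OF P]]
        bounded_clinear_cadjoint X)
  show "cinner (X (P (cadjoint X x))) y = cinner x (X (P (cadjoint X y)))" for x y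
    by (simp add: positive_op_sym[OF P] flip: cadjoint_cinner[OF X] cadjoint_cinner_right[OF X])
  show "0 \<le> Re (cinner x (X (P (cadjoint X x))))" for x
    using positive_op_nonneg[OF P, of "cadjoint X x"] by (simp add: cadjoint_cinner[OF X])
qed

lemma positive_op_zero: "positive_op (\<lambda>_. 0)"
  by (rule positive_opI) (simp_all add: bounded_clinear_zero_op)

lemma positive_op_sum:
  "(\<And>i. i \<in> F \<Longrightarrow> positive_op (A i)) \<Longrightarrow> positive_op (\<lambda>u. \<Sum>i\<in>F. A i u)"
  by (rule positive_opI)
    (auto intro!: bounded_clinear_sum_op sum_nonneg sum.cong
      simp: positive_op_bounded cinner_sum_left cinner_sum_right positive_op_sym positive_op_nonneg)

lemma positive_op_diff:
  assumes "positive_op P" "positive_op Q" "\<And>x. Re (cinner x (Q x)) \<le> Re (cinner x (P x))"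
  shows "positive_op (\<lambda>u. P u - Q u)"
  using assms
  by (intro positive_opI bounded_clinear_minus_op)
    (simp_all add: positive_op_bounded cinner_diff_left cinner_diff_right positive_op_sym)

lemma has_sum_quadratic_form:
  assumes "trace_has_sum A I S"
  shows "((\<lambda>i. Re (cinner x (A i x))) has_sum Re (cinner x (S x))) I"
  by (intro has_sum_Re has_sum_bounded_linear[OF bounded_bilinear.bounded_linear_right[OF bounded_bilinear_cinner]]
      trace_has_sum_pointwise assms)

lemma trace_has_sum_positive:
  assumes S: "trace_has_sum A I S" and A: "\<And>i. i \<in> I \<Longrightarrow> positive_op (A i)"
  shows "positive_op S"
proof (rule positive_opI)
  show "bounded_clinear S" using S by (simp add: trace_has_sum_def trace_class_def)
  show "cinner (S x) y = cinner x (S y)" for x y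
  proof (rule has_sum_unique)
    show "((\<lambda>i. cinner (A i x) y) has_sum cinner (S x) y) I"
      by (rule has_sum_bounded_linear[OF bounded_bilinear.bounded_linear_left[OF bounded_bilinear_cinner]
            trace_has_sum_pointwise[OF S]])
    have "((\<lambda>i. cinner x (A i y)) has_sum cinner x (S y)) I"
      by (rule has_sum_bounded_linear[OF bounded_bilinear.bounded_linear_right[OF bounded_bilinear_cinner]
            trace_has_sum_pointwise[OF S]])
    then show "((\<lambda>i. cinner (A i x) y) has_sum cinner x (S y)) I"
      by (rule has_sum_cong[THEN iffD1, rotated]) (simp add: positive_op_sym A)
  qed
  show "0 \<le> Re (cinner x (S x))" for x
    by (rule has_sum_nonneg[OF has_sum_quadratic_form[OF S]]) (simp add: positive_op_nonneg A)
qed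

lemma sum_over_Sigma:
  assumes "finite X" "\<And>x. finite (Y x)"
  shows "(\<Sum>p\<in>Sigma X Y. h p) = (\<Sum>x\<in>X. \<Sum>y\<in>Y x. h (x, y))"
  using sum.Sigma[of X Y "\<lambda>x y. h (x, y)"] assms by simp

text \<open>The sum over \<open>x\<close> of the blocks \<open>T x\<close> may be replaced by the unconditional sum over all pairs of the
pieces of the blocks. For finite \<open>F\<close> the remainder \<open>R F\<close> is positive, since \<open>F\<close> lies within
finitely many blocks up to vanishing terms, and it decreases as \<open>F\<close> grows. Once \<open>F\<close> contains the
blocks over \<open>X\<close>, its trace norm is at most that of the remainder of the block sum over \<open>X\<close>.\<close>

lemma trace_has_sum_refine:
  fixes A :: "'i \<times> 'j \<Rightarrow> 'a::chilbert_space \<Rightarrow> 'a"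
  assumes T: "trace_has_sum T UNIV S" and Tp: "\<And>x. positive_op (T x)"
    and Ap: "\<And>p. positive_op (A p)"
    and fin: "\<And>x. finite (Y x)"
    and zero: "\<And>x y. y \<notin> Y x \<Longrightarrow> A (x, y) = (\<lambda>_. 0)"
    and fibre: "\<And>x u. (\<Sum>y\<in>Y x. A (x, y) u) = T x u"
  shows "trace_has_sum A UNIV S"
  unfolding trace_has_sum_def
proof (intro conjI ballI)
  show "trace_class S" using T by (simp add: trace_has_sum_def)
  have Tc: "trace_class (T x)" for x using T by (simp add: trace_has_sum_def)
  have Sp: "positive_op S" using T Tp by (rule trace_has_sum_positive)
  define q where "q P v = Re (cinner v (P v))" for P :: "'a \<Rightarrow> 'a" and v
  have qA: "0 \<le> q (A p) v" for p v unfolding q_def by (rule positive_op_nonneg[OF Ap])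
  have qT: "q (T x) v = (\<Sum>y\<in>Y x. q (A (x, y)) v)" for x v
    by (simp add: q_def fibre[symmetric] cinner_sum_right)
  have fib: "(\<Sum>p\<in>Sigma X Y. A p u) = (\<Sum>x\<in>X. T x u)" if "finite X" for X u
    by (simp add: sum_over_Sigma that fin fibre)
  show "trace_class (A p)" for p
  proof (cases p)
    case (Pair x y)
    have "trace_norm (A p) \<le> trace_norm (T x)"
    proof (cases "y \<in> Y x")
      case True
      show ?thesis
      proof (rule trace_norm_mono[OF Ap Tp])
        show "Re (cinner v (A p v)) \<le> Re (cinner v (T x v))" for v
          using member_le_sum[OF True, of "\<lambda>y. q (A (x, y)) v"] qA fin Pair qT[of x v]
          by (simp add: q_def)
      qed
    next
      case False
      then show ?thesis
        using positive_op_nonneg[OF Tp] by (intro trace_norm_mono Ap Tp) (simp add: Pair zero)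
    qed
    then show ?thesis using Tc[of x] Ap[of p] unfolding trace_class_def
      by (auto simp: positive_op_bounded intro: le_less_trans)
  qed
  have below: "(\<Sum>x\<in>X. q (T x) v) \<le> q S v" if "finite X" for X v
    unfolding q_def
    using has_sum_mono_neutral[OF has_sum_finite[OF that] has_sum_quadratic_form[OF T]]
      positive_op_nonneg[OF Tp] by simp
  have qsub: "(\<Sum>p\<in>F. q (A p) v) \<le> (\<Sum>p\<in>F'. q (A p) v)" if "finite F'" "\<And>p. p \<in> F \<Longrightarrow> p \<in> F' \<or> snd p \<notin> Y (fst p)" "finite F" for F F' v
  proof -
    have "(\<Sum>p\<in>F. q (A p) v) = (\<Sum>p\<in>F \<inter> F'. q (A p) v)"
    proof (intro sum.mono_neutral_right ballI)
      fix p assume "p \<in> F - F \<inter> F'"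
      then have "snd p \<notin> Y (fst p)" using that(2) by blast
      then have "A (fst p, snd p) = (\<lambda>_. 0)" by (rule zero)
      then show "q (A p) v = 0" by (simp add: q_def)
    qed (use that in auto)
    also have "\<dots> \<le> (\<Sum>p\<in>F'. q (A p) v)" using that qA by (intro sum_mono2) auto
    finally show ?thesis .
  qed
  define R where "R F u = S u - (\<Sum>p\<in>F. A p u)" for F u
  have R: "positive_op (R F)" if "finite F" for F
    unfolding R_def
  proof (rule positive_op_diff[OF Sp])
    show "positive_op (\<lambda>u. \<Sum>p\<in>F. A p u)" by (rule positive_op_sum) (rule Ap)
    fix v
    have "(\<Sum>p\<in>F. q (A p) v) \<le> (\<Sum>p\<in>Sigma (fst ` F) Y. q (A p) v)"
      using that fin by (intro qsub) (force simp: image_iff)+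
    also have "\<dots> = (\<Sum>x\<in>fst ` F. q (T x) v)" using that by (simp add: sum_over_Sigma fin qT)
    also have "\<dots> \<le> q S v" using that by (intro below) simp
    finally show "Re (cinner v (\<Sum>p\<in>F. A p v)) \<le> Re (cinner v (S v))"
      by (simp add: q_def cinner_sum_right)
  qed
  have trR: "trace_norm (\<lambda>u. (\<Sum>p\<in>F. A p u) - S u) = trace_norm (R F)" if "finite F" for F
    using trace_norm_neg_positive[OF R[OF that]] by (simp add: R_def)
  show "((\<lambda>F. trace_norm (\<lambda>u. (\<Sum>p\<in>F. A p u) - S u)) \<longlongrightarrow> 0) (finite_subsets_at_top UNIV)"
  proof (rule order_tendstoI)
    fix a :: ennreal assume "0 < a"
    have "((\<lambda>X. trace_norm (\<lambda>u. (\<Sum>x\<in>X. T x u) - S u)) \<longlongrightarrow> 0) (finite_subsets_at_top UNIV)"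
      using T by (simp add: trace_has_sum_def)
    then have "\<forall>\<^sub>F X in finite_subsets_at_top UNIV. trace_norm (\<lambda>u. (\<Sum>x\<in>X. T x u) - S u) < a"
      using \<open>0 < a\<close> by (rule order_tendstoD)
    then obtain X where X: "finite X" "trace_norm (\<lambda>u. (\<Sum>x\<in>X. T x u) - S u) < a"
      unfolding eventually_finite_subsets_at_top by blast
    let ?G = "Sigma X Y"
    have G: "finite ?G" using X(1) fin by auto
    have "trace_norm (\<lambda>u. (\<Sum>x\<in>X. T x u) - S u) = trace_norm (R ?G)"
      using trR[OF G] by (simp add: fib[OF X(1)])
    then have small: "trace_norm (R ?G) < a" using X(2) by simp
    have "trace_norm (\<lambda>u. (\<Sum>p\<in>F. A p u) - S u) < a" if F: "finite F" "?G \<subseteq> F" for F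
    proof -
      have "trace_norm (R F) \<le> trace_norm (R ?G)"
      proof (rule trace_norm_mono[OF R[OF F(1)] R[OF G]])
        fix v
        have "(\<Sum>p\<in>?G. q (A p) v) \<le> (\<Sum>p\<in>F. q (A p) v)" using F qA by (intro sum_mono2) auto
        then show "Re (cinner v (R F v)) \<le> Re (cinner v (R ?G v))"
          by (simp add: R_def q_def cinner_diff_right cinner_sum_right)
      qed
      then show ?thesis using small trR[OF F(1)] by simp
    qed
    then show "\<forall>\<^sub>F F in finite_subsets_at_top UNIV. trace_norm (\<lambda>u. (\<Sum>p\<in>F. A p u) - S u) < a"
      unfolding eventually_finite_subsets_at_top using G by blast
  qed simp
qed

section \<open>The evolution equation\<close>

lemma cadjoint_tensor_op_ketbra:
  assumes t: "is_tensor t" and C: "bounded_clinear C" and sym: "\<And>x y. cinner (C x) y = cinner x (C y)"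
  shows "cadjoint (tensor_op t (ketbra e f) C) = (\<lambda>w. t f (C (cadjoint (t e) w)))"
  unfolding tensor_op_ketbra[OF t C]
  by (rule cadjoint_eqI)
    (simp add: sym flip: cadjoint_cinner[OF tensor_left_bounded[OF t]]
      cadjoint_cinner_right[OF tensor_left_bounded[OF t]])

text \<open>By orthogonality of the blocks only the term \<open>x = y\<close> survives the compression.\<close>

lemma state_compression:
  assumes t: "is_tensor t" and cl: "is_l2 cl"
    and w: "\<And>x. bounded_clinear (w x)"
    and W: "trace_has_sum (\<lambda>x. tensor_op t (ketbra (delta cl x) (delta cl x)) (w x)) UNIV W"
  shows "cadjoint (t (delta cl y)) (W (t (delta cl y) v)) = w y v"
proof -
  let ?V = "\<lambda>x. t (delta cl x)"
  note tb = tensor_left_bounded[OF t]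
  have "((\<lambda>x. cadjoint (?V y) (tensor_op t (ketbra (delta cl x) (delta cl x)) (w x) (?V y v)))
      has_sum cadjoint (?V y) (W (?V y v))) UNIV"
    by (rule has_sum_bounded_linear[OF bounded_clinear_bl[OF bounded_clinear_cadjoint[OF tb]]
          trace_has_sum_pointwise[OF W]])
  moreover have "cadjoint (?V y) (tensor_op t (ketbra (delta cl x) (delta cl x)) (w x) (?V y v))
      = (if x = y then w y v else 0)" for x
    by (simp add: tensor_op_ketbra[OF t w] cadjoint_tensor_left[OF t] cinner_delta[OF cl]
        bounded_clinear_zero[OF w] bounded_clinear_zero[OF tb] scaleC_one)
  ultimately have "((\<lambda>x. if x = y then w y v else 0) has_sum cadjoint (?V y) (W (?V y v))) UNIV" by simp
  moreover have "((\<lambda>x. if x = y then w y v else 0) has_sum w y v) UNIV"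
    by (rule has_sum_finite_neutralI[of "{y}"]) auto
  ultimately show ?thesis by (rule has_sum_unique)
qed

theorem theorem2p7:
  fixes p :: "nat \<Rightarrow> real"
    and P :: "(nat \<Rightarrow> real) measure"
    and cls :: "((nat \<Rightarrow> real) \<Rightarrow> complex) \<Rightarrow> 'h::chilbert_space"
    and D :: "nat \<Rightarrow> 'h \<Rightarrow> 'h"
    and tp :: "('d::finite \<Rightarrow> 'h) \<Rightarrow> 't::chilbert_space"
    and K :: "'t \<Rightarrow> 'h"
    and cl :: "(int ^ 'd \<Rightarrow> complex) \<Rightarrow> 'l::chilbert_space"
    and t :: "'l \<Rightarrow> 'h \<Rightarrow> 'k::chilbert_space"
    and W :: "nat \<Rightarrow> 'k \<Rightarrow> 'k"
    and n :: nat
  assumes "CARD('d) \<ge> 2"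
    and "\<And>n. 0 < p n \<and> p n < 1"
    and "bernoulli_measure p P"
    and "is_L2 P cls"
    and "annihilation_ops p cls D"
    and "is_tensor_power tp"
    and "unitary_iso K"
    and "is_l2 cl"
    and "is_tensor t"
    and "qbn_state_sequence D tp K cl t W"
  shows "W (Suc n) = M_map D tp K cl t n (W n)"
proof -
  note tp = \<open>is_tensor_power tp\<close> and K = \<open>unitary_iso K\<close> and cl = \<open>is_l2 cl\<close> and t = \<open>is_tensor t\<close>
  obtain \<omega> where \<omega>: "\<And>n. has_nucleus cl t (W n) (\<omega> n)"
    and step: "\<And>n. \<omega> (Suc n) = J_map D tp K n (\<omega> n)"
    using \<open>qbn_state_sequence D tp K cl t W\<close> unfolding qbn_state_sequence_def by blast
  have D: "bounded_clinear (D n)"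
    using \<open>annihilation_ops p cls D\<close> by (simp add: annihilation_ops_def)
  let ?V = "\<lambda>x. t (delta cl x)"
  let ?C = "C_op D tp K n"
  let ?M = "M_op D tp K cl t n"
  note tb = tensor_left_bounded[OF t] and C = C_op_bounded_symmetric[of D n, OF D tp K]
  define T where "T m x = tensor_op t (ketbra (delta cl x) (delta cl x)) (\<omega> m x)" for m x
  have pos: "positive_op (\<omega> m x)" for m x using \<omega>[of m] by (simp add: has_nucleus_def nucleus_def)
  have T: "trace_has_sum (T m) UNIV (W m)" for m
    using \<omega>[of m] by (simp add: has_nucleus_def T_def[abs_def])
  have T_eq: "T m x = (\<lambda>w. ?V x (\<omega> m x (cadjoint (?V x) w)))" for m x
    unfolding T_def by (rule tensor_op_ketbra[OF t positive_op_bounded[OF pos]])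
  have comp: "cadjoint (?V y) (W n (?V y v)) = \<omega> n y v" for y v
    using T[of n] by (intro state_compression[OF t cl positive_op_bounded[OF pos]]) (simp add: T_def[abs_def])
  define A where "A = (\<lambda>(x, y). ?M x y \<circ> W n \<circ> cadjoint (?M x y))"
  have A_in: "A (x, y) = (\<lambda>w. ?V x (?C (x - y) (\<omega> n y (?C (x - y) (cadjoint (?V x) w)))))"
    if "x - y \<in> Lambda_d" for x y
  proof -
    have M: "?M x y = tensor_op t (ketbra (delta cl x) (delta cl y)) (?C (x - y))"
      using that by (simp add: M_op_def)
    have "cadjoint (?M x y) = (\<lambda>w. ?V y (?C (x - y) (cadjoint (?V x) w)))"
      unfolding M by (rule cadjoint_tensor_op_ketbra[OF t C])
    moreover have "?M x y = (\<lambda>w. ?V x (?C (x - y) (cadjoint (?V y) w)))"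
      unfolding M by (rule tensor_op_ketbra[OF t C(1)])
    ultimately show ?thesis by (simp add: A_def o_def comp)
  qed
  have A_out: "A (x, y) = (\<lambda>_. 0)" if "x - y \<notin> Lambda_d" for x y
    using that by (auto simp: A_def M_op_def)
  have "trace_has_sum A UNIV (W (Suc n))"
  proof (rule trace_has_sum_refine[OF T[of "Suc n"]])
    show "positive_op (T (Suc n) x)" for x
      unfolding T_eq by (rule positive_op_conj[OF pos tb])
    show "positive_op (A q)" for q
    proof (cases q)
      case (Pair x y)
      show ?thesis
      proof (cases "x - y \<in> Lambda_d")
        case True
        have VC: "bounded_clinear (\<lambda>w. ?V x (?C (x - y) w))" by (rule bounded_clinear_comp[OF tb C(1)])
        have "cadjoint (\<lambda>w. ?V x (?C (x - y) w)) = (\<lambda>w. ?C (x - y) (cadjoint (?V x) w))"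
          by (rule cadjoint_eqI) (simp add: C(2) cadjoint_cinner[OF tb])
        then show ?thesis using positive_op_conj[OF pos[of n y] VC] by (simp add: Pair A_in[OF True])
      next
        case False
        then show ?thesis by (simp add: Pair A_out positive_op_zero)
      qed
    qed
    show "finite ((\<lambda>\<epsilon>. x - \<epsilon>) ` Lambda_d)" for x :: "int ^ 'd" by (intro finite_imageI finite_Lambda_d)
    show "A (x, y) = (\<lambda>_. 0)" if "y \<notin> (\<lambda>\<epsilon>. x - \<epsilon>) ` Lambda_d" for x y
    proof (rule A_out)
      show "x - y \<notin> Lambda_d" using that by (metis diff_diff_eq2 add_diff_cancel_left' rev_image_eqI)
    qed
    show "(\<Sum>y\<in>(\<lambda>\<epsilon>. x - \<epsilon>) ` Lambda_d. A (x, y) u) = T (Suc n) x u" for x u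
    proof -
      have "(\<Sum>y\<in>(\<lambda>\<epsilon>. x - \<epsilon>) ` Lambda_d. A (x, y) u) = (\<Sum>\<epsilon>\<in>Lambda_d. A (x, x - \<epsilon>) u)"
        by (subst sum.reindex) (auto simp: inj_on_def)
      also have "\<dots> = (\<Sum>\<epsilon>\<in>Lambda_d. ?V x (?C \<epsilon> (\<omega> n (x - \<epsilon>) (?C \<epsilon> (cadjoint (?V x) u)))))"
        by (intro sum.cong refl) (simp add: A_in)
      also have "\<dots> = T (Suc n) x u"
        by (simp add: T_eq step J_map_def bounded_clinear_sum[OF tb])
      finally show ?thesis .
    qed
  qed
  then show ?thesis unfolding M_map_def A_def by (rule trace_infsum_eqI[symmetric])
qed

end
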